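(* Let $\mathbb A$ be a (fixed) graph of groups with finite vertex groups over a finite directed graph $A$, with base vertex $v$, explicitly given together with a presentation $\mathrm{Bass}(\mathbb A)=\langle X\mid R\rangle$ as described in the context, and such that for every vertex group, every element lying in the image of some incident edge group is assigned a symbol as a generator of that vertex group. Then there is an algorithm that takes as input a word $W\in(X^{\pm1})^*$ representing an element of $\pi_1(\mathbb A,v)$ and outputs a reduced word $\bar W$ such that $\epsilon(W)=\epsilon(\bar W)$, and which runs in time $O(M\log^*(M))$ where $M=|W|$.
   Context: **Graphs of groups.** A directed graph has vertices, edges, and initial/terminal maps $i,t$; $e^{-1}$ is the reverse of $e$, $i(e^{-1})=t(e)$, $t(e^{-1})=i(e)$. A graph of groups $\mathbb A$ over $A$ assigns a group $\mathbb A_w$ to each vertex, $\mathbb A_e$ to each edge, and monomorphisms $i_e:\mathbb A_e\to\mathbb A_{i(e)}$, $t_e:\mathbb A_e\to\mathbb A_{t(e)}$. **Presentation.** For each vertex $w$ fix a finite tuple $\mathscr G_w$ of symbols generating $\mathbb A_w$ (all symbols for different vertices distinct) and a finite presentation $\mathbb A_w=\langle\mathscr G_w\mid R_w\rangle$. For each edge $e$ and $h\in\mathbb A_e$ fix a word $W(t_e(h))$ in $\mathscr G_{t(e)}^{\pm1}$ representing $t_e(h)$ and a word $V(i_e(h))$ in $\mathscr G_{i(e)}^{\pm1}$ representing $i_e(h)$; under the hypothesis of the statement these words are the single symbols assigned to $t_e(h)$ and $i_e(h)$. Put $X=\mathrm{Edges}(A)\cup\bigcup_w\mathscr G_w$,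 $R=\{eW(t_e(h))e^{-1}V(i_e(h))^{-1}: e\in\mathrm{Edges}(A),h\in\mathbb A_e\}\cup\bigcup_wR_w$, $\mathrm{Bass}(\mathbb A)=\langle X\mid R\rangle$, with evaluation map $\epsilon:(X^{\pm1})^*\to\mathrm{Bass}(\mathbb A)$; $|W|$ is the length of a word. **Fundamental group and words.** $\pi_1(\mathbb A,v)\le\mathrm{Bass}(\mathbb A)$ is the subgroup of elements $a_0e_1^{\epsilon_1}a_1\cdots e_p^{\epsilon_p}a_p$ where $e_1^{\epsilon_1}\cdots e_p^{\epsilon_p}$ is a (possibly empty) loop at $v$ in $A$, $a_0\in\mathbb A_v$, $a_j\in\mathbb A_{t(e_j^{\epsilon_j})}$. A word $W$ represents $g\in\pi_1(\mathbb A,v)$ if $\epsilon(W)=g$ and $W=W_0e_1^{\epsilon_1}W_1\cdots e_p^{\epsilon_p}W_p$ with $e_1^{\epsilon_1}\cdots e_p^{\epsilon_p}$ a loop at $v$ in $A$, $W_0\in(\mathscr G_v^{\pm1})^*$, $W_j\in(\mathscr G_{t(e_j^{\epsilon_j})}^{\pm1})^*$. **Reduced words.** A word is cancellable if it is of the form $eWe^{-1}$ with $e\in\mathrm{Edges}(A)$, $W\in(\mathscr G_{t(e)}^{\pm1})^*$, $\epsilon(W)\in t_e(\mathbb A_e)$, or $e^{-1}Ve$ with $V\in(\mathscr G_{i(e)}^{\pm1})^*$, $\epsilon(V)\in i_e(\mathbb A_e)$. A word is reduced if it is freely reduced (no subword $xx^{-1}$ or $x^{-1}x$) and has no cancellable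 subword. **Running time** is the count of pointer operations and operations on integers of uniformly bounded size; $\log^*(n)=\min\{m: n\le 2^*(m)\}$ with $2^*(0)=1$, $2^*(n+1)=2^{2^*(n)}$; $O(f(M))$ means bounded by a constant (depending on $\mathbb A$ and its presentation) times $f(M)$ for all large $M$. *)

theory Defs
  imports
    "HOL-Algebra.Group"
    "Graph_Theory.Digraph"
    "HOL-Library.Landau_Symbols"
    "HOL-Library.Sublist"
begin

section \<open>Words and group presentations\<close>

text \<open>
  A signed letter \<open>(x, True)\<close> stands for \<open>x\<close> and \<open>(x, False)\<close> for its formal inverse.
\<close>

type_synonym 'a sletter = "'a \<times> bool"
type_synonym 'a sword = "'a sletter list"

definition swords :: "'a set \<Rightarrow> 'a sword set" where
  "swords S = lists (S \<times> UNIV)"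

definition inv_letter :: "'a sletter \<Rightarrow> 'a sletter" where
  "inv_letter l = (fst l, \<not> snd l)"

definition inv_word :: "'a sword \<Rightarrow> 'a sword" where
  "inv_word w = rev (map inv_letter w)"

definition freely_reduced :: "'a sword \<Rightarrow> bool" where
  "freely_reduced w \<longleftrightarrow> \<not> (\<exists>l. sublist [l, inv_letter l] w)"

inductive pres_eq :: "'a set \<Rightarrow> 'a sword set \<Rightarrow> 'a sword \<Rightarrow> 'a sword \<Rightarrow> bool"
  for S :: "'a set" and R :: "'a sword set" where
  refl: "w \<in> swords S \<Longrightarrow> pres_eq S R w w"
| sym: "pres_eq S R u w \<Longrightarrow> pres_eq S R w u"
| trans: "pres_eq S R u v \<Longrightarrow> pres_eq S R v w \<Longrightarrow> pres_eq S R u w"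
| cancel: "u \<in> swords S \<Longrightarrow> w \<in> swords S \<Longrightarrow> l \<in> S \<times> UNIV \<Longrightarrow>
    pres_eq S R (u @ [l, inv_letter l] @ w) (u @ w)"
| relator: "u \<in> swords S \<Longrightarrow> w \<in> swords S \<Longrightarrow> r \<in> R \<Longrightarrow> r \<in> swords S \<Longrightarrow>
    pres_eq S R (u @ r @ w) (u @ w)"

definition pres_class :: "'a set \<Rightarrow> 'a sword set \<Rightarrow> 'a sword \<Rightarrow> 'a sword set" where
  "pres_class S R w = {u. pres_eq S R w u}"

text \<open>The group \<open>\<langle>S | R\<rangle>\<close>.\<close>

definition pres_group :: "'a set \<Rightarrow> 'a sword set \<Rightarrow> 'a sword set monoid" where
  "pres_group S R =
    \<lparr> carrier = swords S // {(u, w). pres_eq S R u w},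
      mult = (\<lambda>C D. \<Union>u\<in>C. \<Union>w\<in>D. pres_class S R (u @ w)),
      one = pres_class S R [] \<rparr>"

fun word_value :: "('g, 'm) monoid_scheme \<Rightarrow> ('a \<Rightarrow> 'g) \<Rightarrow> 'a sword \<Rightarrow> 'g" where
  "word_value G f [] = \<one>\<^bsub>G\<^esub>"
| "word_value G f ((x, b) # w) = (if b then f x else inv\<^bsub>G\<^esub> (f x)) \<otimes>\<^bsub>G\<^esub> word_value G f w"

text \<open>\<open>G = \<langle>S | R\<rangle>\<close>, where the symbol \<open>x \<in> S\<close> denotes the element \<open>f x\<close> of \<open>G\<close>.\<close>

definition presents :: "('g, 'm) monoid_scheme \<Rightarrow> 'a set \<Rightarrow> ('a \<Rightarrow> 'g) \<Rightarrow> 'a sword set \<Rightarrow> bool" where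
  "presents G S f R \<longleftrightarrow>
    R \<subseteq> swords S \<and> f ` S \<subseteq> carrier G \<and>
    (\<exists>\<phi> \<in> iso (pres_group S R) G. \<forall>x\<in>S. \<phi> (pres_class S R [(x, True)]) = f x)"


subsection \<open>\<open>\<langle>S | R\<rangle>\<close> is a group\<close>

lemma swords_simps [simp]:
  "[] \<in> swords S"
  "l # w \<in> swords S \<longleftrightarrow> fst l \<in> S \<and> w \<in> swords S"
  "u @ w \<in> swords S \<longleftrightarrow> u \<in> swords S \<and> w \<in> swords S"
  by (auto simp: swords_def mem_Times_iff)

lemma inv_word_swords [simp]: "w \<in> swords S \<Longrightarrow> inv_word w \<in> swords S"
  by (induction w) (auto simp: inv_word_def inv_letter_def)

lemma pres_eq_swords: "pres_eq S R u w \<Longrightarrow> u \<in> swords S \<and> w \<in> swords S"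
  by (induction rule: pres_eq.induct) (auto simp: inv_letter_def)

lemma pres_eq_append_left: "pres_eq S R u w \<Longrightarrow> a \<in> swords S \<Longrightarrow> pres_eq S R (a @ u) (a @ w)"
proof (induction rule: pres_eq.induct)
  case (cancel u w l)
  then show ?case using pres_eq.cancel[of "a @ u" S w l R] by simp
next
  case (relator u w r)
  then show ?case using pres_eq.relator[of "a @ u" S w r R] by simp
next
  case (trans u v w)
  then show ?case using pres_eq.trans by blast
qed (simp_all add: pres_eq.refl pres_eq.sym)

lemma pres_eq_append_right: "pres_eq S R u w \<Longrightarrow> a \<in> swords S \<Longrightarrow> pres_eq S R (u @ a) (w @ a)"
proof (induction rule: pres_eq.induct)
  case (cancel u w l)
  then show ?case using pres_eq.cancel[of u S "w @ a" l R] by simp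
next
  case (relator u w r)
  then show ?case using pres_eq.relator[of u S "w @ a" r R] by simp
next
  case (trans u v w)
  then show ?case using pres_eq.trans by blast
qed (simp_all add: pres_eq.refl pres_eq.sym)

lemma pres_eq_append:
  "pres_eq S R u u' \<Longrightarrow> pres_eq S R w w' \<Longrightarrow> pres_eq S R (u @ w) (u' @ w')"
  by (rule pres_eq.trans[OF pres_eq_append_right pres_eq_append_left])
    (auto dest: pres_eq_swords)

lemma pres_class_eq_iff:
  assumes u: "u \<in> swords S"
  shows "pres_class S R u = pres_class S R w \<longleftrightarrow> pres_eq S R u w"
proof
  assume "pres_class S R u = pres_class S R w"
  moreover have "u \<in> pres_class S R u"
    using u by (simp add: pres_class_def pres_eq.refl)
  ultimately show "pres_eq S R u w"
    by (simp add: pres_class_def pres_eq.sym)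
next
  assume uw: "pres_eq S R u w"
  show "pres_class S R u = pres_class S R w"
    using pres_eq.trans[OF uw] pres_eq.trans[OF pres_eq.sym[OF uw]]
    by (auto simp: pres_class_def)
qed

lemma carrier_pres_group: "carrier (pres_group S R) = pres_class S R ` swords S"
  by (auto simp: pres_group_def quotient_def pres_class_def Image_def)

lemma mult_pres_group:
  assumes "u \<in> swords S" "w \<in> swords S"
  shows "pres_class S R u \<otimes>\<^bsub>pres_group S R\<^esub> pres_class S R w = pres_class S R (u @ w)"
proof -
  have eq: "pres_class S R (a @ b) = pres_class S R (u @ w)"
    if "a \<in> pres_class S R u" "b \<in> pres_class S R w" for a b
    using that pres_eq_append[of S R u a w b] assms pres_class_eq_iff[of "u @ w" S R "a @ b"]
    by (auto simp: pres_class_def)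
  have mem: "u \<in> pres_class S R u" "w \<in> pres_class S R w"
    using assms by (simp_all add: pres_class_def pres_eq.refl)
  have "pres_class S R u \<otimes>\<^bsub>pres_group S R\<^esub> pres_class S R w =
      (\<Union>a\<in>pres_class S R u. \<Union>b\<in>pres_class S R w. pres_class S R (u @ w))"
    by (simp add: pres_group_def eq cong: SUP_cong)
  then show ?thesis
    using mem by auto
qed

lemma pres_eq_inv_word: "w \<in> swords S \<Longrightarrow> pres_eq S R (inv_word w @ w) []"
proof (induction w)
  case Nil
  then show ?case by (auto simp: inv_word_def intro: pres_eq.refl)
next
  case (Cons l w)
  have "pres_eq S R (inv_word w @ [inv_letter l, inv_letter (inv_letter l)] @ w) (inv_word w @ w)"
    using Cons.prems by (intro pres_eq.cancel) (auto simp: inv_letter_def)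
  moreover have "pres_eq S R (inv_word w @ w) []"
    using Cons by simp
  ultimately have "pres_eq S R (inv_word w @ [inv_letter l, inv_letter (inv_letter l)] @ w) []"
    by (rule pres_eq.trans)
  then show ?case
    by (simp add: inv_word_def inv_letter_def)
qed

lemma group_pres_group: "group (pres_group S R)"
proof (rule groupI)
  show one: "\<one>\<^bsub>pres_group S R\<^esub> \<in> carrier (pres_group S R)"
    by (auto simp: carrier_pres_group) (auto simp: pres_group_def)
  have one_eq: "\<one>\<^bsub>pres_group S R\<^esub> = pres_class S R []"
    by (simp add: pres_group_def)
  show "\<exists>y\<in>carrier (pres_group S R). y \<otimes>\<^bsub>pres_group S R\<^esub> x = \<one>\<^bsub>pres_group S R\<^esub>"
    if x: "x \<in> carrier (pres_group S R)" for x
  proof -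
    from x obtain w where w: "w \<in> swords S" "x = pres_class S R w"
      by (auto simp: carrier_pres_group)
    then have "pres_class S R (inv_word w) \<otimes>\<^bsub>pres_group S R\<^esub> x = \<one>\<^bsub>pres_group S R\<^esub>"
      by (simp add: mult_pres_group one_eq pres_class_eq_iff pres_eq_inv_word)
    then show ?thesis using w by (auto simp: carrier_pres_group)
  qed
  show "\<one>\<^bsub>pres_group S R\<^esub> \<otimes>\<^bsub>pres_group S R\<^esub> x = x" if "x \<in> carrier (pres_group S R)" for x
    using that by (auto simp: carrier_pres_group one_eq mult_pres_group)
qed (auto simp: carrier_pres_group mult_pres_group)


section \<open>Graphs of groups\<close>

text \<open>
  The initial and terminal maps of the underlying directed multigraph are \<open>tail\<close> and \<open>head\<close>.
\<close>

record ('v, 'e, 'g, 'h) graph_of_groups =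
  graph :: "('v, 'e) pre_digraph"
  vgrp :: "'v \<Rightarrow> 'g monoid"
  egrp :: "'e \<Rightarrow> 'h monoid"
  imap :: "'e \<Rightarrow> 'h \<Rightarrow> 'g"
  tmap :: "'e \<Rightarrow> 'h \<Rightarrow> 'g"

definition is_graph_of_groups :: "('v, 'e, 'g, 'h, 'z) graph_of_groups_scheme \<Rightarrow> bool" where
  "is_graph_of_groups A \<longleftrightarrow>
    wf_digraph (graph A) \<and>
    (\<forall>w \<in> verts (graph A). group (vgrp A w)) \<and>
    (\<forall>e \<in> arcs (graph A).
        group (egrp A e) \<and>
        imap A e \<in> mon (egrp A e) (vgrp A (tail (graph A) e)) \<and>
        tmap A e \<in> mon (egrp A e) (vgrp A (head (graph A) e)))"

text \<open>
  A graph of groups with the data for a presentation of its Bass group: at each vertex \<open>w\<close> the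
  symbols \<open>gens w\<close>, where \<open>x\<close> denotes the element \<open>den w x\<close>, and the relators \<open>rels w\<close>; for
  \<open>h\<close> in the group of the edge \<open>e\<close>, words \<open>tword e h\<close> and \<open>iword e h\<close> for its two images.
\<close>

record ('v, 'e, 'g, 'h, 's) presented_gog = "('v, 'e, 'g, 'h) graph_of_groups" +
  gens :: "'v \<Rightarrow> 's set"
  den :: "'v \<Rightarrow> 's \<Rightarrow> 'g"
  rels :: "'v \<Rightarrow> 's sword set"
  tword :: "'e \<Rightarrow> 'h \<Rightarrow> 's sword"
  iword :: "'e \<Rightarrow> 'h \<Rightarrow> 's sword"

definition is_presented_gog :: "('v, 'e, 'g, 'h, 's) presented_gog \<Rightarrow> bool" where
  "is_presented_gog A \<longleftrightarrow>
    is_graph_of_groups A \<and>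
    (\<forall>w \<in> verts (graph A). \<forall>w' \<in> verts (graph A). w \<noteq> w' \<longrightarrow> gens A w \<inter> gens A w' = {}) \<and>
    (\<forall>w \<in> verts (graph A).
        finite (gens A w) \<and> finite (rels A w) \<and>
        presents (vgrp A w) (gens A w) (den A w) (rels A w)) \<and>
    (\<forall>e \<in> arcs (graph A). \<forall>h \<in> carrier (egrp A e).
        (let w = head (graph A) e in
          tword A e h \<in> swords (gens A w) \<and>
          word_value (vgrp A w) (den A w) (tword A e h) = tmap A e h) \<and>
        (let w = tail (graph A) e in
          iword A e h \<in> swords (gens A w) \<and>
          word_value (vgrp A w) (den A w) (iword A e h) = imap A e h))"

text \<open>The elements of the vertex group at \<open>w\<close> lying in the image of an incident edge group.\<close>

definition edge_images :: "('v, 'e, 'g, 'h, 'z) graph_of_groups_scheme \<Rightarrow> 'v \<Rightarrow> 'g set" where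
  "edge_images A w =
    (\<Union>e \<in> {e \<in> arcs (graph A). head (graph A) e = w}. tmap A e ` carrier (egrp A e)) \<union>
    (\<Union>e \<in> {e \<in> arcs (graph A). tail (graph A) e = w}. imap A e ` carrier (egrp A e))"

text \<open>
  Every element \<open>a\<close> of the vertex group at \<open>w\<close> in the image of an incident edge group is assigned
  the symbol \<open>\<sigma> w a\<close>, and these single symbols are the chosen words for the edge relations.
\<close>

definition symbol_assignment ::
  "('v, 'e, 'g, 'h, 's) presented_gog \<Rightarrow> ('v \<Rightarrow> 'g \<Rightarrow> 's) \<Rightarrow> bool" where
  "symbol_assignment A \<sigma> \<longleftrightarrow>
    (\<forall>w \<in> verts (graph A). \<forall>a \<in> edge_images A w. \<sigma> w a \<in> gens A w \<and> den A w (\<sigma> w a) = a) \<and>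
    (\<forall>e \<in> arcs (graph A). \<forall>h \<in> carrier (egrp A e).
        tword A e h = [(\<sigma> (head (graph A) e) (tmap A e h), True)] \<and>
        iword A e h = [(\<sigma> (tail (graph A) e) (imap A e h), True)])"


section \<open>The Bass group and the fundamental group\<close>

datatype ('e, 's) bass_sym = Edge 'e | Gen 's

definition bass_gens :: "('v, 'e, 'g, 'h, 's) presented_gog \<Rightarrow> ('e, 's) bass_sym set" where
  "bass_gens A = Edge ` arcs (graph A) \<union> (\<Union>w \<in> verts (graph A). Gen ` gens A w)"

definition vword :: "'s sword \<Rightarrow> ('e, 's) bass_sym sword" where
  "vword w = map (map_prod Gen id) w"

definition bass_rels :: "('v, 'e, 'g, 'h, 's) presented_gog \<Rightarrow> ('e, 's) bass_sym sword set" where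
  "bass_rels A =
    {[(Edge e, True)] @ vword (tword A e h) @ [(Edge e, False)] @ inv_word (vword (iword A e h))
      | e h. e \<in> arcs (graph A) \<and> h \<in> carrier (egrp A e)} \<union>
    (\<Union>w \<in> verts (graph A). vword ` rels A w)"

definition bass_group ::
  "('v, 'e, 'g, 'h, 's) presented_gog \<Rightarrow> ('e, 's) bass_sym sword set monoid" where
  "bass_group A = pres_group (bass_gens A) (bass_rels A)"

definition eps ::
  "('v, 'e, 'g, 'h, 's) presented_gog \<Rightarrow> ('e, 's) bass_sym sword \<Rightarrow> ('e, 's) bass_sym sword set" where
  "eps A W = pres_class (bass_gens A) (bass_rels A) W"

definition vwords :: "('v, 'e, 'g, 'h, 's) presented_gog \<Rightarrow> 'v \<Rightarrow> ('e, 's) bass_sym sword set" where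
  "vwords A w = swords (Gen ` gens A w)"

text \<open>The vertex group at \<open>w\<close>, as a subset of the Bass group.\<close>

definition vertex_part ::
  "('v, 'e, 'g, 'h, 's) presented_gog \<Rightarrow> 'v \<Rightarrow> ('e, 's) bass_sym sword set set" where
  "vertex_part A w = eps A ` vwords A w"

text \<open>The images of the edge group at \<open>e\<close> in its two vertex groups, as subsets of the Bass group.\<close>

definition t_part ::
  "('v, 'e, 'g, 'h, 's) presented_gog \<Rightarrow> 'e \<Rightarrow> ('e, 's) bass_sym sword set set" where
  "t_part A e = (\<lambda>h. eps A (vword (tword A e h))) ` carrier (egrp A e)"

definition i_part ::
  "('v, 'e, 'g, 'h, 's) presented_gog \<Rightarrow> 'e \<Rightarrow> ('e, 's) bass_sym sword set set" where
  "i_part A e = (\<lambda>h. eps A (vword (iword A e h))) ` carrier (egrp A e)"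

text \<open>Initial and terminal vertices of signed edges, with \<open>i(e\<^sup>-\<^sup>1) = t(e)\<close> and \<open>t(e\<^sup>-\<^sup>1) = i(e)\<close>.\<close>

fun sinit :: "('v, 'e) pre_digraph \<Rightarrow> 'e sletter \<Rightarrow> 'v" where
  "sinit G (e, b) = (if b then tail G e else head G e)"

fun sterm :: "('v, 'e) pre_digraph \<Rightarrow> 'e sletter \<Rightarrow> 'v" where
  "sterm G (e, b) = (if b then head G e else tail G e)"

fun is_path :: "('v, 'e) pre_digraph \<Rightarrow> 'v \<Rightarrow> 'e sword \<Rightarrow> 'v \<Rightarrow> bool" where
  "is_path G u [] v \<longleftrightarrow> u = v \<and> u \<in> verts G"
| "is_path G u (d # p) v \<longleftrightarrow> fst d \<in> arcs G \<and> sinit G d = u \<and> is_path G (sterm G d) p v"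

definition edge_letter :: "'e sletter \<Rightarrow> ('e, 's) bass_sym sletter" where
  "edge_letter d = (Edge (fst d), snd d)"

text \<open>
  In the next two definitions, the list \<open>p\<close> consists of the pairs \<open>(e\<^sub>j\<^sup>\<epsilon>\<^sup>j, a\<^sub>j)\<close>, respectively
  \<open>(e\<^sub>j\<^sup>\<epsilon>\<^sup>j, W\<^sub>j)\<close>.
\<close>

definition pi1 ::
  "('v, 'e, 'g, 'h, 's) presented_gog \<Rightarrow> 'v \<Rightarrow> ('e, 's) bass_sym sword set set" where
  "pi1 A v =
    {a0 \<otimes>\<^bsub>bass_group A\<^esub>
        foldr (\<lambda>(d, a) g. eps A [edge_letter d] \<otimes>\<^bsub>bass_group A\<^esub> (a \<otimes>\<^bsub>bass_group A\<^esub> g)) p \<one>\<^bsub>bass_group A\<^esub>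
      | a0 p. is_path (graph A) v (map fst p) v \<and> a0 \<in> vertex_part A v \<and>
              (\<forall>(d, a) \<in> set p. a \<in> vertex_part A (sterm (graph A) d))}"

definition represents ::
  "('v, 'e, 'g, 'h, 's) presented_gog \<Rightarrow> 'v \<Rightarrow> ('e, 's) bass_sym sword \<Rightarrow>
    ('e, 's) bass_sym sword set \<Rightarrow> bool" where
  "represents A v W g \<longleftrightarrow>
    eps A W = g \<and>
    (\<exists>W0 p. W = W0 @ concat (map (\<lambda>(d, U). edge_letter d # U) p) \<and>
            is_path (graph A) v (map fst p) v \<and> W0 \<in> vwords A v \<and>
            (\<forall>(d, U) \<in> set p. U \<in> vwords A (sterm (graph A) d)))"

definition cancellable ::
  "('v, 'e, 'g, 'h, 's) presented_gog \<Rightarrow> ('e, 's) bass_sym sword \<Rightarrow> bool" where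
  "cancellable A U \<longleftrightarrow>
    (\<exists>e \<in> arcs (graph A).
      (\<exists>W \<in> vwords A (head (graph A) e).
          U = [(Edge e, True)] @ W @ [(Edge e, False)] \<and> eps A W \<in> t_part A e) \<or>
      (\<exists>V \<in> vwords A (tail (graph A) e).
          U = [(Edge e, False)] @ V @ [(Edge e, True)] \<and> eps A V \<in> i_part A e))"

definition reduced ::
  "('v, 'e, 'g, 'h, 's) presented_gog \<Rightarrow> ('e, 's) bass_sym sword \<Rightarrow> bool" where
  "reduced A W \<longleftrightarrow>
    W \<in> swords (bass_gens A) \<and> freely_reduced W \<and> \<not> (\<exists>U. sublist U W \<and> cancellable A U)"


section \<open>Pointer machines\<close>

text \<open>
  A machine has pointer registers, integer registers and an unbounded supply of memory cells.
  A cell has pointer fields and integer fields. A pointer is nil (\<open>None\<close>) or the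
  address of an allocated cell; addresses can only be copied, compared for equality and
  dereferenced. A program mentions only finitely many registers and fields. Integers are
  bounded by a constant \<open>B\<close> belonging to the program, so the operation in \<open>IOp\<close>, which is
  taken modulo \<open>B\<close> and is only ever applied to arguments below \<open>B\<close>, amounts to a finite table.
  Targets of jumps are absolute positions in the program.
\<close>

type_synonym ptr = "nat option"

datatype instr =
    PNil nat                                 \<comment> \<open>\<open>p := nil\<close>\<close>
  | PMove nat nat                            \<comment> \<open>\<open>p := q\<close>\<close>
  | PNew nat                                 \<comment> \<open>\<open>p := \<close> a fresh cell, its fields being nil and 0\<close>
  | PLoad nat nat nat                        \<comment> \<open>\<open>p := q.f\<close>\<close>
  | PStore nat nat nat                       \<comment> \<open>\<open>p.f := q\<close>\<close>
  | IConst nat nat                           \<comment> \<open>\<open>c := n\<close>\<close>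
  | IOp nat "nat \<Rightarrow> nat \<Rightarrow> nat" nat nat      \<comment> \<open>\<open>c := op a b\<close>\<close>
  | ILoad nat nat nat                        \<comment> \<open>\<open>c := p.f\<close>\<close>
  | IStore nat nat nat                       \<comment> \<open>\<open>p.f := c\<close>\<close>
  | Jump nat
  | JumpPEq nat nat nat                      \<comment> \<open>jump to \<open>l\<close> if the pointers \<open>p\<close>, \<open>q\<close> are equal\<close>
  | JumpIEq nat nat nat                      \<comment> \<open>jump to \<open>l\<close> if the integers \<open>a\<close>, \<open>b\<close> are equal\<close>

record mstate =
  pc :: nat
  preg :: "nat \<Rightarrow> ptr"
  ireg :: "nat \<Rightarrow> nat"
  pfield :: "nat \<Rightarrow> nat \<Rightarrow> ptr"
  ifield :: "nat \<Rightarrow> nat \<Rightarrow> nat"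
  next_free :: nat

fun exec :: "nat \<Rightarrow> instr \<Rightarrow> mstate \<Rightarrow> mstate" where
  "exec B (PNil p) s = s\<lparr>preg := (preg s)(p := None), pc := Suc (pc s)\<rparr>"
| "exec B (PMove p q) s = s\<lparr>preg := (preg s)(p := preg s q), pc := Suc (pc s)\<rparr>"
| "exec B (PNew p) s =
    s\<lparr>preg := (preg s)(p := Some (next_free s)),
      pfield := (pfield s)(next_free s := (\<lambda>_. None)),
      ifield := (ifield s)(next_free s := (\<lambda>_. 0)),
      next_free := Suc (next_free s), pc := Suc (pc s)\<rparr>"
| "exec B (PLoad p q f) s = (case preg s q of None \<Rightarrow> s
    | Some c \<Rightarrow> s\<lparr>preg := (preg s)(p := pfield s c f), pc := Suc (pc s)\<rparr>)"
| "exec B (PStore p f q) s = (case preg s p of None \<Rightarrow> s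
    | Some c \<Rightarrow> s\<lparr>pfield := (pfield s)(c := (pfield s c)(f := preg s q)), pc := Suc (pc s)\<rparr>)"
| "exec B (IConst c n) s = s\<lparr>ireg := (ireg s)(c := n mod B), pc := Suc (pc s)\<rparr>"
| "exec B (IOp c op a b) s =
    s\<lparr>ireg := (ireg s)(c := op (ireg s a) (ireg s b) mod B), pc := Suc (pc s)\<rparr>"
| "exec B (ILoad c p f) s = (case preg s p of None \<Rightarrow> s
    | Some d \<Rightarrow> s\<lparr>ireg := (ireg s)(c := ifield s d f), pc := Suc (pc s)\<rparr>)"
| "exec B (IStore p f c) s = (case preg s p of None \<Rightarrow> s
    | Some d \<Rightarrow> s\<lparr>ifield := (ifield s)(d := (ifield s d)(f := ireg s c)), pc := Suc (pc s)\<rparr>)"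
| "exec B (Jump l) s = s\<lparr>pc := l\<rparr>"
| "exec B (JumpPEq p q l) s = s\<lparr>pc := if preg s p = preg s q then l else Suc (pc s)\<rparr>"
| "exec B (JumpIEq a b l) s = s\<lparr>pc := if ireg s a = ireg s b then l else Suc (pc s)\<rparr>"

text \<open>
  The machine halts when \<open>pc\<close> leaves the program. Dereferencing nil leaves the whole state
  unchanged, including \<open>pc\<close>, so that the machine hangs without ever halting.
\<close>

definition halted :: "instr list \<Rightarrow> mstate \<Rightarrow> bool" where
  "halted P s \<longleftrightarrow> pc s \<ge> length P"

definition step :: "nat \<Rightarrow> instr list \<Rightarrow> mstate \<Rightarrow> mstate" where
  "step B P s = (if halted P s then s else exec B (P ! pc s) s)"

text \<open>
  Words of integers are stored as nil-terminated linked lists: the integer field 0 of a cell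
  contains the letter, the pointer field 0 points to the next cell. The input is initially in
  pointer register 0, where the output is expected on halting.
\<close>

definition init_state :: "nat list \<Rightarrow> mstate" where
  "init_state xs =
    \<lparr> pc = 0,
      preg = (\<lambda>p. if p = 0 \<and> xs \<noteq> [] then Some 0 else None),
      ireg = (\<lambda>_. 0),
      pfield = (\<lambda>c f. if f = 0 \<and> Suc c < length xs then Some (Suc c) else None),
      ifield = (\<lambda>c f. if f = 0 \<and> c < length xs then xs ! c else 0),
      next_free = length xs \<rparr>"

fun spells :: "mstate \<Rightarrow> ptr \<Rightarrow> nat list \<Rightarrow> bool" where
  "spells s q [] \<longleftrightarrow> q = None"
| "spells s q (x # xs) \<longleftrightarrow>
    (\<exists>c. q = Some c \<and> ifield s c 0 = x \<and> spells s (pfield s c 0) xs)"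

definition computes_in :: "nat \<Rightarrow> instr list \<Rightarrow> nat list \<Rightarrow> nat \<Rightarrow> nat list \<Rightarrow> bool" where
  "computes_in B P xs n ys \<longleftrightarrow>
    (let s = (step B P ^^ n) (init_state xs) in halted P s \<and> spells s (preg s 0) ys)"


section \<open>Iterated logarithm\<close>

fun two_star :: "nat \<Rightarrow> nat" where
  "two_star 0 = 1"
| "two_star (Suc n) = 2 ^ two_star n"

definition log_star :: "nat \<Rightarrow> nat" where
  "log_star n = (LEAST m. n \<le> two_star m)"

end

theory Submission
  imports Defs
begin

text \<open>
  Scan the input from left to right, storing the part read so far as a reduced word
  \<open>a\<^sub>0 d\<^sub>1 a\<^sub>1 \<dots> d\<^sub>k a\<^sub>k\<close> on a stack of pairs \<open>(a\<^sub>j\<^sub>-\<^sub>1, d\<^sub>j)\<close>, where \<open>d\<^sub>j\<close> is a signed edge and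
  \<open>a\<^sub>j\<close> a shortest word for an element of a vertex group; as the vertex groups are finite, only
  finitely many words \<open>a\<^sub>j\<close> occur. A vertex letter changes \<open>a\<^sub>k\<close> only. An edge letter is pushed,
  unless it is inverse to \<open>d\<^sub>k\<close> and \<open>d\<^sub>k a\<^sub>k d\<^sub>k\<^sup>-\<^sup>1\<close> equals a vertex word, in which case the top of
  the stack is popped. Finally the stack is written out. This takes a bounded number of steps per
  input letter, so the time is even linear.

  The finite tables of the algorithm are defined through equality in the Bass group instead of
  equality in the vertex groups. This is also how cancellable words are defined, so that the
  injectivity of the vertex groups in the Bass group plays no role.
\<close>

section \<open>Two-stack machines as pointer programs\<close>

text \<open>An intermediate model between the algorithm and pointer programs. The input list also
  serves as the output list, refilled by \<open>PushIn\<close>. Popping an empty list is allowed and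
  is reported to the continuation as \<open>None\<close>.\<close>

datatype ('q, 'c, 'l) action =
  Halt
| PopIn "'l option \<Rightarrow> 'q"
| PopStack "'c option \<Rightarrow> 'q"
| PushIn 'l 'q
| PushStack 'c 'q

fun pop :: "'a list \<Rightarrow> 'a option \<times> 'a list" where
  "pop [] = (None, [])"
| "pop (x # xs) = (Some x, xs)"

fun stack_step ::
  "('q \<Rightarrow> ('q, 'c, 'l) action) \<Rightarrow> 'q \<times> 'l list \<times> 'c list \<Rightarrow> 'q \<times> 'l list \<times> 'c list" where
  "stack_step M (q, u, s) = (case M q of
      Halt \<Rightarrow> (q, u, s)
    | PopIn f \<Rightarrow> (f (fst (pop u)), snd (pop u), s)
    | PopStack f \<Rightarrow> (f (fst (pop s)), u, snd (pop s))
    | PushIn l q' \<Rightarrow> (q', l # u, s)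
    | PushStack c q' \<Rightarrow> (q', u, c # s))"

text \<open>Strengthens \<open>spells\<close> by keeping all addresses below
  \<open>next_free\<close>, so that allocating and filling a fresh cell leaves the lists already
  stored intact.\<close>

fun allocated_list :: "mstate \<Rightarrow> ptr \<Rightarrow> nat list \<Rightarrow> bool" where
  "allocated_list s p [] \<longleftrightarrow> p = None"
| "allocated_list s p (x # xs) \<longleftrightarrow>
    (\<exists>c<next_free s. p = Some c \<and> ifield s c 0 = x \<and> allocated_list s (pfield s c 0) xs)"

lemma allocated_list_cong:
  assumes "allocated_list s p xs"
    and "\<And>c. c < next_free s \<Longrightarrow> ifield t c = ifield s c \<and> pfield t c = pfield s c"
    and "next_free s \<le> next_free t"
  shows "allocated_list t p xs"
  using assms(1)
proof (induction xs arbitrary: p)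
  case (Cons x xs)
  then show ?case using assms(2,3) by fastforce
qed simp

lemma allocated_list_update [simp]:
  "allocated_list (s\<lparr>pc := i\<rparr>) p xs = allocated_list s p xs"
  "allocated_list (s\<lparr>preg := f\<rparr>) p xs = allocated_list s p xs"
  "allocated_list (s\<lparr>ireg := g\<rparr>) p xs = allocated_list s p xs"
  by (induction xs arbitrary: p) auto

lemma allocated_list_spells: "allocated_list s p xs \<Longrightarrow> spells s p xs"
  by (induction xs arbitrary: p) auto

section \<open>A pointer program that runs a two-stack machine\<close>

definition stack_prog ::
  "nat \<Rightarrow> (nat \<Rightarrow> nat) \<Rightarrow> (nat \<Rightarrow> nat) \<Rightarrow> (nat \<Rightarrow> nat \<Rightarrow> nat) \<Rightarrow> instr list" where
  "stack_prog q0 kind val nxt =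
    [IConst 0 q0, IConst 4 1, IConst 5 2, IConst 6 3, Jump 5,
     IOp 2 (\<lambda>q _. kind q) 0 0,  \<comment> \<open>5: main loop, with the state in integer register 0\<close>
     IConst 1 0,
     JumpIEq 2 3 12, JumpIEq 2 4 17, JumpIEq 2 5 22, JumpIEq 2 6 28, Jump 36,
     JumpPEq 0 2 34,            \<comment> \<open>12: pop from the input; pointer register 2 stays nil\<close>
     ILoad 1 0 0, IOp 1 (\<lambda>x _. Suc x) 1 1, PLoad 0 0 0, Jump 34,
     JumpPEq 1 2 34,            \<comment> \<open>17: pop from the stack\<close>
     ILoad 1 1 0, IOp 1 (\<lambda>x _. Suc x) 1 1, PLoad 1 1 0, Jump 34,
     IOp 8 (\<lambda>q _. val q) 0 0,   \<comment> \<open>22: push on the input\<close>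
     PNew 3, IStore 3 0 8, PStore 3 0 0, PMove 0 3, Jump 34,
     IOp 8 (\<lambda>q _. val q) 0 0,   \<comment> \<open>28: push on the stack\<close>
     PNew 3, IStore 3 0 8, PStore 3 0 1, PMove 1 3, Jump 34,
     IOp 0 nxt 0 1,            \<comment> \<open>34: enter the next state\<close>
     Jump 5]"

text \<open>Integer registers 3 to 6 hold the constants with which the kind of the current action is
  compared; pointer register 2 is a constant nil. The input and the stack start at pointer registers
  0 and 1.\<close>

definition loop_inv :: "mstate \<Rightarrow> nat \<Rightarrow> nat list \<Rightarrow> nat list \<Rightarrow> bool" where
  "loop_inv s q xs ys \<longleftrightarrow>
    pc s = 5 \<and> ireg s 0 = q \<and> ireg s 3 = 0 \<and> ireg s 4 = 1 \<and> ireg s 5 = 2 \<and> ireg s 6 = 3 \<and>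
    preg s 2 = None \<and> allocated_list s (preg s 0) xs \<and> allocated_list s (preg s 1) ys"

text \<open>The result of a pop as left in integer register 1: letters are shifted by one so that 0
  can signal an empty list.\<close>

fun pop_code :: "nat list \<Rightarrow> nat" where
  "pop_code [] = 0"
| "pop_code (x # xs) = Suc x"

lemma funpow_step_numeral: "(f ^^ numeral k) s = (f ^^ pred_numeral k) (f s)"
  by (simp add: numeral_eq_Suc funpow_swap1)

lemma funpow_step_Suc: "(f ^^ Suc k) s = (f ^^ k) (f s)"
  by (simp add: funpow_swap1)

context
  fixes B q0 :: nat and kind val :: "nat \<Rightarrow> nat" and nxt :: "nat \<Rightarrow> nat \<Rightarrow> nat"
  assumes B: "4 < B"
begin

abbreviation "prg \<equiv> stack_prog q0 kind val nxt"

text \<open>Resolving the premise \<open>prg = P\<close> with \<open>stack_prog_def\<close> gives a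
  rewrite rule that spells out the program only where an instruction is fetched and leaves it folded
  elsewhere.\<close>

lemma step_stack_prog:
  "prg = P \<Longrightarrow> pc s < 36 \<Longrightarrow> step B prg s = exec B (P ! pc s) s"
  by (auto simp: step_def halted_def stack_prog_def)

lemmas run_simps = loop_inv_def Let_def funpow_step_numeral funpow_step_Suc
  step_stack_prog[OF stack_prog_def]

lemma halted_stack_prog: "halted prg s \<longleftrightarrow> 36 \<le> pc s"
  by (auto simp: halted_def stack_prog_def)

lemma pop_in_simulation:
  assumes "loop_inv s q xs ys" "kind q = 0" "\<forall>x\<in>set xs. Suc x < B"
  shows "\<exists>m\<le>15. loop_inv ((step B prg ^^ m) s) (nxt q (pop_code xs) mod B) (snd (pop xs)) ys"
proof (cases xs)
  case Nil
  \<comment> \<open>The step counts here and below are lengths of paths through the program; each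
    further kind of action costs one more comparison. The uniform bound 15 covers them all.\<close>
  show ?thesis
    using assms B Nil
    by (intro exI[of _ 6]) (auto simp: run_simps elim: allocated_list_cong)
next
  case (Cons x us)
  obtain c where c: "c < next_free s" "preg s 0 = Some c" "ifield s c 0 = x"
    "allocated_list s (pfield s c 0) us" and x: "Suc x < B"
    using assms(1,3) Cons by (auto simp: loop_inv_def)
  have s: "pc s = 5" "ireg s 0 = q" "ireg s 3 = 0" "ireg s 4 = Suc 0" "ireg s 5 = 2" "ireg s 6 = 3"
    "preg s 2 = None" "allocated_list s (preg s (Suc 0)) ys"
    using assms(1) by (auto simp: loop_inv_def)
  show ?thesis
    using B x by (intro exI[of _ 10]) (simp add: run_simps s c Cons assms(2))
qed

lemma pop_stack_simulation:
  assumes "loop_inv s q xs ys" "kind q = 1" "\<forall>x\<in>set ys. Suc x < B"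
  shows "\<exists>m\<le>15. loop_inv ((step B prg ^^ m) s) (nxt q (pop_code ys) mod B) xs (snd (pop ys))"
proof (cases ys)
  case Nil
  show ?thesis
    using assms B Nil
    by (intro exI[of _ 7]) (auto simp: run_simps elim: allocated_list_cong)
next
  case (Cons x us)
  obtain c where c: "c < next_free s" "preg s (Suc 0) = Some c" "ifield s c 0 = x"
    "allocated_list s (pfield s c 0) us" and x: "Suc x < B"
    using assms(1,3) Cons by (auto simp: loop_inv_def)
  have s: "pc s = 5" "ireg s 0 = q" "ireg s 3 = 0" "ireg s 4 = Suc 0" "ireg s 5 = 2" "ireg s 6 = 3"
    "preg s 2 = None" "allocated_list s (preg s 0) xs"
    using assms(1) by (auto simp: loop_inv_def)
  show ?thesis
    using B x by (intro exI[of _ 11]) (simp add: run_simps s c Cons assms(2))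
qed

lemma push_in_simulation:
  assumes "loop_inv s q xs ys" "kind q = 2" "val q < B"
  shows "\<exists>m\<le>15. loop_inv ((step B prg ^^ m) s) (nxt q 0 mod B) (val q # xs) ys"
  using assms B
  by (intro exI[of _ 13]) (auto simp: run_simps elim: allocated_list_cong)

lemma push_stack_simulation:
  assumes "loop_inv s q xs ys" "kind q = 3" "val q < B"
  shows "\<exists>m\<le>15. loop_inv ((step B prg ^^ m) s) (nxt q 0 mod B) xs (val q # ys)"
  using assms B
  by (intro exI[of _ 14]) (auto simp: run_simps elim: allocated_list_cong)

lemma halt_simulation:
  assumes "loop_inv s q xs ys" "kind q = 4"
  shows "\<exists>m\<le>15. let t = (step B prg ^^ m) s in halted prg t \<and> spells t (preg t 0) xs"
  using assms B
  by (intro exI[of _ 7])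
      (auto simp: run_simps halted_stack_prog intro!: allocated_list_spells)

lemma init_simulation:
  assumes "q0 < B"
  shows "loop_inv ((step B prg ^^ 5) (init_state xs)) q0 xs []"
proof -
  \<comment> \<open>Generalised to suffixes for the induction: cell \<open>i\<close> is the head of
    the list \<open>drop i xs\<close>, and past the end the pointer is nil.\<close>
  have al: "allocated_list (init_state xs) (if i < length xs then Some i else None) (drop i xs)" for i
  proof (induction "length xs - i" arbitrary: i)
    case (Suc k)
    then have "i < length xs" by simp
    then have d: "drop i xs = xs ! i # drop (Suc i) xs" by (simp add: Cons_nth_drop_Suc)
    show ?case
      using Suc(1)[of "Suc i"] Suc(2) \<open>i < length xs\<close> unfolding d by (simp add: init_state_def)
  qed simp
  have "allocated_list (init_state xs) (preg (init_state xs) 0) xs"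
    using al[of 0] by (auto simp: init_state_def)
  moreover have "pc (init_state xs) = 0" "ireg (init_state xs) = (\<lambda>_. 0)"
    "preg (init_state xs) (Suc 0) = None" "preg (init_state xs) 2 = None"
    by (simp_all add: init_state_def)
  ultimately show ?thesis
    using assms B by (auto simp: run_simps elim: allocated_list_cong)
qed

end

section \<open>Coding a finite control by integer tables\<close>

definition actions_within ::
  "'q set \<Rightarrow> 'c set \<Rightarrow> 'l set \<Rightarrow> ('q, 'c, 'l) action \<Rightarrow> bool" where
  "actions_within Q C X a = (case a of
      Halt \<Rightarrow> True
    | PopIn f \<Rightarrow> f None \<in> Q \<and> (\<forall>x\<in>X. f (Some x) \<in> Q)
    | PopStack f \<Rightarrow> f None \<in> Q \<and> (\<forall>c\<in>C. f (Some c) \<in> Q)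
    | PushIn l q \<Rightarrow> l \<in> X \<and> q \<in> Q
    | PushStack c q \<Rightarrow> c \<in> C \<and> q \<in> Q)"

text \<open>The types of states and stack symbols may be infinite, but \<open>actions_within\<close>
  confines a run to finite sets, which can be numbered. Transitions then become finite integer
  tables, and each action costs a bounded number of instructions.\<close>

lemma stack_machine_simulation:
  fixes M :: "'q \<Rightarrow> ('q, 'c, 'l) action" and code :: "'l \<Rightarrow> nat"
  assumes fin: "finite Q" "finite C" "finite X" and code: "inj_on code X"
    and q0: "q0 \<in> Q" and M: "\<And>q. q \<in> Q \<Longrightarrow> actions_within Q C X (M q)"
  obtains B P where "0 < B" "\<And>l. l \<in> X \<Longrightarrow> code l < B"
    "\<And>u n q u' s'. set u \<subseteq> X \<Longrightarrow> (stack_step M ^^ n) (q0, u, []) = (q, u', s') \<Longrightarrow> M q = Halt \<Longrightarrow>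
      \<exists>m \<le> 15 * n + 20. computes_in B P (map code u) m (map code u')"
proof -
  obtain eq :: "'q \<Rightarrow> nat" and nq where eq: "inj_on eq Q" "eq ` Q = {i. i < nq}"
    using finite_imp_inj_to_nat_seg[OF fin(1)] by metis
  obtain ec :: "'c \<Rightarrow> nat" and nc where ec: "inj_on ec C" "ec ` C = {i. i < nc}"
    using finite_imp_inj_to_nat_seg[OF fin(2)] by metis
  define dq where "dq = inv_into Q eq"
  define dc where "dc = inv_into C ec"
  define dl where "dl = inv_into X code"
  have d [simp]: "q \<in> Q \<Longrightarrow> dq (eq q) = q" "c \<in> C \<Longrightarrow> dc (ec c) = c" "l \<in> X \<Longrightarrow> dl (code l) = l"
    for q c l
    using eq ec code by (simp_all add: dq_def dc_def dl_def)
  \<comment> \<open>Large enough that reduction modulo \<open>B\<close> changes no code of a state,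
    no shifted code of a letter or stack symbol, and none of the five kinds of action.\<close>
  define B where "B = 5 + nq + nc + Suc (Max (insert 0 (code ` X)))"
  have codeB: "Suc (code l) < B" if "l \<in> X" for l
  proof -
    have "code l \<le> Max (insert 0 (code ` X))"
      using that fin by (intro Max_ge) auto
    then show ?thesis by (simp add: B_def)
  qed
  have eqB: "eq q < B" if "q \<in> Q" for q
  proof -
    have "eq q < nq" using eq(2) that by auto
    then show ?thesis by (simp add: B_def)
  qed
  have ecB: "Suc (ec c) < B" if "c \<in> C" for c
  proof -
    have "ec c < nc" using ec(2) that by auto
    then show ?thesis by (simp add: B_def)
  qed
  define kind where "kind n = (case M (dq n) of
    PopIn _ \<Rightarrow> 0 | PopStack _ \<Rightarrow> 1 | PushIn _ _ \<Rightarrow> 2 | PushStack _ _ \<Rightarrow> 3 | Halt \<Rightarrow> (4 :: nat))" for n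
  define val where "val n = (case M (dq n) of PushIn l _ \<Rightarrow> code l | PushStack c _ \<Rightarrow> ec c | _ \<Rightarrow> 0)" for n
  \<comment> \<open>Decode, apply the transition and encode again; \<open>x - 1\<close> undoes the
    shift in \<open>pop_code\<close>.\<close>
  define nxt where "nxt n x = eq (case M (dq n) of
      PopIn f \<Rightarrow> f (if x = 0 then None else Some (dl (x - 1)))
    | PopStack f \<Rightarrow> f (if x = 0 then None else Some (dc (x - 1)))
    | PushIn _ q \<Rightarrow> q | PushStack _ q \<Rightarrow> q | Halt \<Rightarrow> dq n)" for n x
  let ?P = "stack_prog (eq q0) kind val nxt"
  have B: "4 < B" by (simp add: B_def)
  have one: "q' \<in> Q \<and> set u' \<subseteq> X \<and> set s' \<subseteq> C \<and>
      (\<exists>m\<le>15. loop_inv ((step B ?P ^^ m) st) (eq q') (map code u') (map ec s'))"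
    if q: "q \<in> Q" and u: "set u \<subseteq> X" and s: "set s \<subseteq> C"
      and inv: "loop_inv st (eq q) (map code u) (map ec s)"
      and st: "stack_step M (q, u, s) = (q', u', s')" for st q u s q' u' s'
  proof (cases "M q")
    case Halt
    then show ?thesis using that by (auto intro: exI[of _ 0])
  next
    case (PopIn f)
    have k: "kind (eq q) = 0" using q PopIn by (simp add: kind_def)
    have q': "q' \<in> Q" using M[OF q] PopIn st u by (cases u) (auto simp: actions_within_def)
    have "\<forall>x\<in>set (map code u). Suc x < B" using u codeB by auto
    note pop_in_simulation[where kind = kind and val = val and nxt = nxt and ?q0.0 = "eq q0", OF B inv k this]
    moreover have "nxt (eq q) (pop_code (map code u)) mod B = eq q'"
      using q PopIn st u q' eqB[OF q'] by (cases u) (auto simp: nxt_def)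
    ultimately show ?thesis using q' st u s PopIn by (cases u) auto
  next
    case (PopStack f)
    have k: "kind (eq q) = 1" using q PopStack by (simp add: kind_def)
    have q': "q' \<in> Q" using M[OF q] PopStack st s by (cases s) (auto simp: actions_within_def)
    have "\<forall>x\<in>set (map ec s). Suc x < B" using s ecB by auto
    note pop_stack_simulation[where kind = kind and val = val and nxt = nxt and ?q0.0 = "eq q0", OF B inv k this]
    moreover have "nxt (eq q) (pop_code (map ec s)) mod B = eq q'"
      using q PopStack st s q' eqB[OF q'] by (cases s) (auto simp: nxt_def)
    ultimately show ?thesis using q' st u s PopStack by (cases s) auto
  next
    case (PushIn l q1)
    have k: "kind (eq q) = 2" using q PushIn by (simp add: kind_def)
    have q': "q' \<in> Q" "l \<in> X" using M[OF q] PushIn st by (auto simp: actions_within_def)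
    have v: "val (eq q) = code l" using q PushIn by (simp add: val_def)
    then have "val (eq q) < B" using codeB[OF q'(2)] by simp
    note push_in_simulation[where kind = kind and val = val and nxt = nxt and ?q0.0 = "eq q0", OF B inv k this]
    moreover have "nxt (eq q) 0 mod B = eq q'"
      using q PushIn st eqB[OF q'(1)] by (auto simp: nxt_def)
    ultimately show ?thesis using q' st u s PushIn v by auto
  next
    case (PushStack c q1)
    have k: "kind (eq q) = 3" using q PushStack by (simp add: kind_def)
    have q': "q' \<in> Q" "c \<in> C" using M[OF q] PushStack st by (auto simp: actions_within_def)
    have v: "val (eq q) = ec c" using q PushStack by (simp add: val_def)
    then have "val (eq q) < B" using ecB[OF q'(2)] by simp
    note push_stack_simulation[where kind = kind and val = val and nxt = nxt and ?q0.0 = "eq q0", OF B inv k this]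
    moreover have "nxt (eq q) 0 mod B = eq q'"
      using q PushStack st eqB[OF q'(1)] by (auto simp: nxt_def)
    ultimately show ?thesis using q' st u s PushStack v by auto
  qed
  have many: "q' \<in> Q \<and> set u' \<subseteq> X \<and> set s' \<subseteq> C \<and>
      (\<exists>m\<le>15 * n. loop_inv ((step B ?P ^^ m) st) (eq q') (map code u') (map ec s'))"
    if u: "set u \<subseteq> X" and inv: "loop_inv st (eq q0) (map code u) []"
      and st: "(stack_step M ^^ n) (q0, u, []) = (q', u', s')" for st n u q' u' s'
    using st
  proof (induction n arbitrary: q' u' s')
    case 0
    then show ?case using u inv q0 by auto
  next
    case (Suc n)
    obtain q1 u1 s1 where 1: "(stack_step M ^^ n) (q0, u, []) = (q1, u1, s1)" by (metis prod_cases3)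
    obtain m where m: "m \<le> 15 * n" "loop_inv ((step B ?P ^^ m) st) (eq q1) (map code u1) (map ec s1)"
      and 2: "q1 \<in> Q" "set u1 \<subseteq> X" "set s1 \<subseteq> C"
      using Suc.IH[OF 1] by auto
    have "stack_step M (q1, u1, s1) = (q', u', s')" using Suc.prems 1 by simp
    from one[OF 2 m(2) this] obtain k where k: "k \<le> 15"
      "loop_inv ((step B ?P ^^ k) ((step B ?P ^^ m) st)) (eq q') (map code u') (map ec s')"
      and 3: "q' \<in> Q \<and> set u' \<subseteq> X \<and> set s' \<subseteq> C" by auto
    have "loop_inv ((step B ?P ^^ (k + m)) st) (eq q') (map code u') (map ec s')"
      using k(2) by (simp add: funpow_add)
    moreover have "k + m \<le> 15 * Suc n" using k m by simp
    ultimately show ?case using 3 by blast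
  qed
  have "\<exists>m \<le> 15 * n + 20. computes_in B ?P (map code u) m (map code u')"
    if u: "set u \<subseteq> X" and st: "(stack_step M ^^ n) (q0, u, []) = (q, u', s')" and q: "M q = Halt"
    for u n q u' s'
  proof -
    let ?s = "(step B ?P ^^ 5) (init_state (map code u))"
    have init: "loop_inv ?s (eq q0) (map code u) []"
      by (rule init_simulation[OF B eqB[OF q0]])
    from many[OF u init st] obtain m where
      m: "m \<le> 15 * n" "loop_inv ((step B ?P ^^ m) ?s) (eq q) (map code u') (map ec s')" "q \<in> Q"
      by auto
    have "kind (eq q) = 4" using q m(3) by (simp add: kind_def)
    from halt_simulation[where ?q0.0 = "eq q0" and kind = kind and val = val and nxt = nxt, OF B m(2) this]
    obtain k where k: "k \<le> 15" "let t = (step B ?P ^^ k) ((step B ?P ^^ m) ?s) in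
        halted ?P t \<and> spells t (preg t 0) (map code u')" by auto
    have "computes_in B ?P (map code u) (k + (m + 5)) (map code u')"
      using k(2) by (simp add: computes_in_def funpow_add)
    \<comment> \<open>Of the constant 20, the initialisation takes 5 and the final turn of the loop,
      which halts, at most 15.\<close>
    moreover have "k + (m + 5) \<le> 15 * n + 20" using k m by simp
    ultimately show ?thesis by blast
  qed
  moreover have "0 < B" using B by simp
  moreover have "code l < B" if "l \<in> X" for l using codeB[OF that] by simp
  ultimately show ?thesis using that by blast
qed

section \<open>Shortest words for the elements of the vertex groups\<close>

lemma arcs_verts:
  assumes "is_presented_gog A" "fst d \<in> arcs (graph A)"
  shows "sinit (graph A) d \<in> verts (graph A)" "sterm (graph A) d \<in> verts (graph A)"
proof -
  have "wf_digraph (graph A)"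
    using assms by (simp add: is_presented_gog_def is_graph_of_groups_def)
  then show "sinit (graph A) d \<in> verts (graph A)" "sterm (graph A) d \<in> verts (graph A)"
    using assms(2) by (cases d; auto simp: wf_digraph_def)+
qed

lemma sterm_inv_letter: "sterm G (inv_letter d) = sinit G d"
  by (cases d) (simp add: inv_letter_def)

lemma edge_letter_inv_letter: "edge_letter (inv_letter d) = inv_letter (edge_letter d)"
  by (simp add: edge_letter_def inv_letter_def)

abbreviation bass_eq ::
  "('v, 'e, 'g, 'h, 's) presented_gog \<Rightarrow> ('e, 's) bass_sym sword \<Rightarrow> ('e, 's) bass_sym sword \<Rightarrow> bool" where
  "bass_eq A \<equiv> pres_eq (bass_gens A) (bass_rels A)"

lemma pres_eq_context:
  assumes "pres_eq S R u u'" "a \<in> swords S" "b \<in> swords S"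
  shows "pres_eq S R (a @ u @ b) (a @ u' @ b)"
  using assms pres_eq_append_left pres_eq_append_right by blast

lemma vwords_subset: "w \<in> verts (graph A) \<Longrightarrow> vwords A w \<subseteq> swords (bass_gens A)"
  unfolding vwords_def swords_def by (intro lists_mono Sigma_mono) (auto simp: bass_gens_def)

lemma vword_swords: "w \<in> verts (graph A) \<Longrightarrow> u \<in> swords (gens A w) \<Longrightarrow> vword u \<in> swords (bass_gens A)"
  by (induction u) (auto simp: vword_def bass_gens_def)

lemma vwords_eq: "vwords A w = vword ` swords (gens A w)"
proof
  show "vwords A w \<subseteq> vword ` swords (gens A w)"
  proof
    fix U assume "U \<in> vwords A w"
    then show "U \<in> vword ` swords (gens A w)"
    proof (induction U)
      case (Cons l U)
      then obtain u where u: "u \<in> swords (gens A w)" "U = vword u" by (auto simp: vwords_def)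
      obtain s b where "l = (Gen s, b)" "s \<in> gens A w"
        using Cons.prems by (cases l) (auto simp: vwords_def)
      then have "l # U = vword ((s, b) # u)" "(s, b) # u \<in> swords (gens A w)"
        using u by (auto simp: vword_def)
      then show ?case by blast
    qed (auto simp: vword_def intro: rev_image_eqI[of "[]"])
  qed
  have "vword u \<in> vwords A w" if "u \<in> swords (gens A w)" for u
    using that by (induction u) (auto simp: vword_def vwords_def)
  then show "vword ` swords (gens A w) \<subseteq> vwords A w" by auto
qed

text \<open>The relators of a vertex group are among those of the Bass group, so the passage from
  its symbols to Bass generators respects equality.\<close>

lemma vword_pres_eq:
  assumes "w \<in> verts (graph A)" "pres_eq (gens A w) (rels A w) u u'"
  shows "bass_eq A (vword u) (vword u')"
  using assms(2)
proof (induction rule: pres_eq.induct)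
  case (refl u)
  then show ?case using vword_swords[OF assms(1)] by (intro pres_eq.refl)
next
  case (trans u v w)
  then show ?case by (blast intro: pres_eq.trans)
next
  case (cancel u u' l)
  have "map_prod Gen id l \<in> bass_gens A \<times> UNIV"
    using cancel assms(1) by (cases l) (auto simp: bass_gens_def)
  then show ?case
    using pres_eq.cancel[of "vword u" "bass_gens A" "vword u'" "map_prod Gen id l"]
      vword_swords[OF assms(1)] cancel by (cases l) (simp add: vword_def inv_letter_def)
next
  case (relator u u' r)
  have "vword r \<in> bass_rels A" using relator assms(1) by (auto simp: bass_rels_def)
  then show ?case
    using pres_eq.relator[of "vword u" "bass_gens A" "vword u'" "vword r"]
      vword_swords[OF assms(1)] relator by (simp add: vword_def)
qed (rule pres_eq.sym)

text \<open>Words outside \<open>vwords A w\<close> are sent to the empty word, so that all values are representatives.\<close>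

definition rep_word ::
  "('v, 'e, 'g, 'h, 's) presented_gog \<Rightarrow> 'v \<Rightarrow> ('e, 's) bass_sym sword \<Rightarrow> ('e, 's) bass_sym sword" where
  "rep_word A w U = (if w \<in> verts (graph A) \<and> U \<in> vwords A w
     then arg_min length (\<lambda>U'. U' \<in> vwords A w \<and> bass_eq A U U') else [])"

definition vertex_reps :: "('v, 'e, 'g, 'h, 's) presented_gog \<Rightarrow> ('e, 's) bass_sym sword set" where
  "vertex_reps A = insert [] (\<Union>w\<in>verts (graph A). rep_word A w ` vwords A w)"

lemma rep_word_in_vertex_reps: "rep_word A w U \<in> vertex_reps A"
  by (auto simp: vertex_reps_def rep_word_def)

lemma rep_word:
  assumes w: "w \<in> verts (graph A)" and U: "U \<in> vwords A w"
  shows "rep_word A w U \<in> vwords A w" "bass_eq A U (rep_word A w U)"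
    "U' \<in> vwords A w \<Longrightarrow> bass_eq A U U' \<Longrightarrow> length (rep_word A w U) \<le> length U'"
proof -
  let ?P = "\<lambda>U'. U' \<in> vwords A w \<and> bass_eq A U U'"
  have "bass_eq A U U" using vwords_subset[OF w] U by (intro pres_eq.refl) auto
  then have P: "?P U" using U by simp
  have r: "rep_word A w U = arg_min length ?P" using assms by (simp add: rep_word_def)
  from arg_min_natI[of ?P U length] P
  show "rep_word A w U \<in> vwords A w" "bass_eq A U (rep_word A w U)" unfolding r by auto
  show "length (rep_word A w U) \<le> length U'" if "U' \<in> vwords A w" "bass_eq A U U'"
    using arg_min_nat_le[of ?P U' length] that unfolding r by simp
qed

text \<open>Deleting an inverse pair would leave a shorter word at the same vertex for the same
  element of the Bass group, against minimality.\<close>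

lemma freely_reduced_rep_word: "freely_reduced (rep_word A w U)"
proof (cases "w \<in> verts (graph A) \<and> U \<in> vwords A w")
  case True
  note r = rep_word[OF conjunct1[OF True] conjunct2[OF True]]
  show ?thesis
    unfolding freely_reduced_def
  proof
    assume "\<exists>l. sublist [l, inv_letter l] (rep_word A w U)"
    then obtain l x y where xy: "rep_word A w U = x @ [l, inv_letter l] @ y"
      unfolding sublist_def by blast
    then have v: "x @ y \<in> vwords A w" using r(1) by (auto simp: vwords_def)
    have "rep_word A w U \<in> swords (bass_gens A)" using r(2) pres_eq_swords by blast
    then have "bass_eq A (rep_word A w U) (x @ y)"
      unfolding xy by (intro pres_eq.cancel) (auto simp: mem_Times_iff)
    then have "bass_eq A U (x @ y)" using r(2) pres_eq.trans by blast
    from r(3)[OF v this] show False by (simp add: xy)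
  qed
qed (auto simp: rep_word_def freely_reduced_def)

text \<open>Words equal in the vertex group are equal in the Bass group and so share their
  representative; hence a vertex has at most as many representatives as its finite group has
  elements.\<close>

lemma finite_vertex_reps:
  assumes A: "is_presented_gog A" and fin: "finite (verts (graph A))"
    and fing: "\<And>w. w \<in> verts (graph A) \<Longrightarrow> finite (carrier (vgrp A w))"
  shows "finite (vertex_reps A)"
proof -
  have "finite (rep_word A w ` vwords A w)" if w: "w \<in> verts (graph A)" for w
  proof -
    let ?c = "pres_class (gens A w) (rels A w)"
    have "presents (vgrp A w) (gens A w) (den A w) (rels A w)"
      using A w by (auto simp: is_presented_gog_def)
    then obtain \<phi> where "\<phi> \<in> iso (pres_group (gens A w) (rels A w)) (vgrp A w)"
      by (auto simp: presents_def)
    then have "finite (carrier (pres_group (gens A w) (rels A w)))"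
      using fing[OF w] by (auto simp: iso_def dest: bij_betw_finite)
    then have fc: "finite (?c ` swords (gens A w))" by (simp add: carrier_pres_group)
    \<comment> \<open>\<open>rep_word\<close> factors through the finite set of classes:
      \<open>F\<close> evaluates it at one chosen word of each class.\<close>
    define F where "F c = rep_word A w (vword (SOME u. u \<in> swords (gens A w) \<and> ?c u = c))" for c
    have "rep_word A w (vword u) = F (?c u)" if u: "u \<in> swords (gens A w)" for u
    proof -
      define u' where "u' = (SOME u'. u' \<in> swords (gens A w) \<and> ?c u' = ?c u)"
      have "u' \<in> swords (gens A w) \<and> ?c u' = ?c u"
        unfolding u'_def by (rule someI[of _ u]) (use u in simp)
      then have u': "u' \<in> swords (gens A w)" "pres_eq (gens A w) (rels A w) u' u"
        using pres_class_eq_iff[of u'] by auto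
      have e: "bass_eq A (vword u') (vword u)" by (rule vword_pres_eq[OF w u'(2)])
      \<comment> \<open>Both words are equal to the same words, so \<open>arg_min\<close> is applied
        to one and the same predicate and makes the same choice.\<close>
      have "bass_eq A (vword u') = bass_eq A (vword u)"
        using pres_eq.trans[OF e] pres_eq.trans[OF pres_eq.sym[OF e]] by blast
      moreover have "vword u \<in> vwords A w" "vword u' \<in> vwords A w"
        using u u'(1) by (auto simp: vwords_eq)
      ultimately have "rep_word A w (vword u') = rep_word A w (vword u)"
        using w by (simp add: rep_word_def)
      then show ?thesis by (simp add: F_def u'_def)
    qed
    then have "rep_word A w ` vwords A w \<subseteq> F ` ?c ` swords (gens A w)" by (auto simp: vwords_eq)
    then show ?thesis using fc finite_surj by blast
  qed
  then show ?thesis using fin by (simp add: vertex_reps_def)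
qed

section \<open>Conjugating a vertex word by an edge\<close>

definition conjugates_into ::
  "('v, 'e, 'g, 'h, 's) presented_gog \<Rightarrow> 'e sletter \<Rightarrow> ('e, 's) bass_sym sword \<Rightarrow>
    ('e, 's) bass_sym sword \<Rightarrow> bool" where
  "conjugates_into A d U V \<longleftrightarrow> V \<in> vwords A (sinit (graph A) d) \<and>
     bass_eq A (edge_letter d # U @ [inv_letter (edge_letter d)]) V"

text \<open>Makes an inverse pair of edge letters the special case of a cancellation with empty
  middle word.\<close>

lemma conjugates_into_Nil:
  assumes "fst d \<in> arcs (graph A)"
  shows "conjugates_into A d [] []"
  using pres_eq.cancel[of "[]" "bass_gens A" "[]" "edge_letter d"] assms
  by (auto simp: conjugates_into_def vwords_def edge_letter_def bass_gens_def)

lemma conjugates_into_cong: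
  assumes A: "is_presented_gog A" and d: "fst d \<in> arcs (graph A)"
    and "bass_eq A U U'" "conjugates_into A d U V"
  shows "conjugates_into A d U' V"
proof -
  have "edge_letter d \<in> bass_gens A \<times> UNIV" "inv_letter (edge_letter d) \<in> bass_gens A \<times> UNIV"
    using d by (auto simp: edge_letter_def bass_gens_def inv_letter_def)
  then have "bass_eq A ([edge_letter d] @ U' @ [inv_letter (edge_letter d)])
      ([edge_letter d] @ U @ [inv_letter (edge_letter d)])"
    using assms(3) by (intro pres_eq_context) (auto intro: pres_eq.sym)
  then show ?thesis using assms(4) by (auto simp: conjugates_into_def intro: pres_eq.trans)
qed

text \<open>Multiplying the relator of \<open>e\<close> and \<open>h\<close> on the right by the
  word of the initial image gives the first claim. Conjugating this by the inverse of
  \<open>e\<close> and cancelling on both sides gives the second.\<close>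

lemma edge_relation:
  assumes A: "is_presented_gog A" and e: "e \<in> arcs (graph A)" and h: "h \<in> carrier (egrp A e)"
  shows "conjugates_into A (e, True) (vword (tword A e h)) (vword (iword A e h))"
    and "conjugates_into A (e, False) (vword (iword A e h)) (vword (tword A e h))"
proof -
  let ?t = "vword (tword A e h)" and ?i = "vword (iword A e h)"
  let ?e = "(Edge e, True)" and ?f = "(Edge e, False)"
  have w: "head (graph A) e \<in> verts (graph A)" "tail (graph A) e \<in> verts (graph A)"
    using arcs_verts[OF A, of "(e, True)"] e by simp_all
  have tw: "tword A e h \<in> swords (gens A (head (graph A) e))"
    and iw: "iword A e h \<in> swords (gens A (tail (graph A) e))"
    using A e h by (auto simp: is_presented_gog_def Let_def)
  have tb: "?t \<in> swords (bass_gens A)" and ib: "?i \<in> swords (bass_gens A)"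
    by (rule vword_swords[OF w(1) tw], rule vword_swords[OF w(2) iw])
  have tv: "?t \<in> vwords A (head (graph A) e)" and iv: "?i \<in> vwords A (tail (graph A) e)"
    using tw iw by (auto simp: vwords_eq)
  have eb: "Edge e \<in> bass_gens A" using e by (simp add: bass_gens_def)
  have ii: "bass_eq A (inv_word ?i @ ?i) []" by (rule pres_eq_inv_word[OF ib])
  let ?r = "[?e] @ ?t @ [?f] @ inv_word ?i"
  have "?r \<in> bass_rels A" using e h by (auto simp: bass_rels_def)
  then have "bass_eq A ([] @ ?r @ ?i) ([] @ ?i)"
    using eb tb ib by (intro pres_eq.relator) auto
  then have r1: "bass_eq A (?r @ ?i) ?i" by simp
  have "bass_eq A (([?e] @ ?t @ [?f]) @ (inv_word ?i @ ?i) @ []) (([?e] @ ?t @ [?f]) @ [] @ [])"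
    using ii eb tb ib by (intro pres_eq_context) auto
  then have r2: "bass_eq A (?r @ ?i) ([?e] @ ?t @ [?f])" by simp
  have 1: "bass_eq A ([?e] @ ?t @ [?f]) ?i"
    by (rule pres_eq.trans[OF pres_eq.sym[OF r2] r1])
  then show "conjugates_into A (e, True) ?t ?i"
    using iv by (simp add: conjugates_into_def edge_letter_def inv_letter_def)
  have "bass_eq A ([?f] @ ([?e] @ ?t @ [?f]) @ [?e]) ([?f] @ ?i @ [?e])"
    using 1 eb by (intro pres_eq_context) auto
  then have s1: "bass_eq A ([?f, ?e] @ ?t @ [?f, ?e]) ([?f] @ ?i @ [?e])" by simp
  have "bass_eq A ([] @ [?f, inv_letter ?f] @ (?t @ [?f, ?e])) ([] @ (?t @ [?f, ?e]))"
    using eb tb by (intro pres_eq.cancel) auto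
  then have s2: "bass_eq A ([?f, ?e] @ ?t @ [?f, ?e]) (?t @ [?f, ?e])" by (simp add: inv_letter_def)
  have "bass_eq A (?t @ [?f, inv_letter ?f] @ []) (?t @ [])"
    using eb tb by (intro pres_eq.cancel) auto
  then have s3: "bass_eq A (?t @ [?f, ?e]) ?t" by (simp add: inv_letter_def)
  have "bass_eq A ([?f] @ ?i @ [?e]) ?t"
    by (rule pres_eq.trans[OF pres_eq.sym[OF s1] pres_eq.trans[OF s2 s3]])
  then show "conjugates_into A (e, False) ?i ?t"
    using tv by (simp add: conjugates_into_def edge_letter_def inv_letter_def)
qed

text \<open>A signed edge covers both kinds of cancellable word. In the Bass group the middle word
  equals the chosen word of an edge group element, which the edge relation carries to the other end
  of the edge. So excluding such conjugations excludes cancellable subwords.\<close>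

lemma cancellable_conjugates_into:
  assumes A: "is_presented_gog A" and U: "cancellable A U"
  obtains d W V where "fst d \<in> arcs (graph A)" "W \<in> vwords A (sterm (graph A) d)"
    "U = [edge_letter d] @ W @ [edge_letter (inv_letter d)]" "conjugates_into A d W V"
proof -
  have eq: "bass_eq A X W"
    if "eps A W = eps A X" "X \<in> swords (bass_gens A)" for W X
    using that(1)[symmetric] pres_class_eq_iff[OF that(2), where w = W and R = "bass_rels A"] by (simp add: eps_def)
  obtain e where e: "e \<in> arcs (graph A)" and
    "(\<exists>W \<in> vwords A (head (graph A) e).
          U = [(Edge e, True)] @ W @ [(Edge e, False)] \<and> eps A W \<in> t_part A e) \<or>
      (\<exists>V \<in> vwords A (tail (graph A) e).
          U = [(Edge e, False)] @ V @ [(Edge e, True)] \<and> eps A V \<in> i_part A e)"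
    using U by (auto simp: cancellable_def)
  then show ?thesis
  proof (elim disjE bexE conjE)
    fix W assume W: "W \<in> vwords A (head (graph A) e)"
      and U: "U = [(Edge e, True)] @ W @ [(Edge e, False)]" and t: "eps A W \<in> t_part A e"
    obtain h where h: "h \<in> carrier (egrp A e)" "eps A W = eps A (vword (tword A e h))"
      using t by (auto simp: t_part_def)
    note r = edge_relation(1)[OF A e h(1)]
    then have "vword (tword A e h) \<in> swords (bass_gens A)"
      by (auto simp: conjugates_into_def dest!: pres_eq_swords)
    then have "conjugates_into A (e, True) W (vword (iword A e h))"
      using conjugates_into_cong[OF A _ eq[OF h(2)] r] e by simp
    then show ?thesis using that[of "(e, True)"] W e U by (auto simp: edge_letter_def inv_letter_def)
  next
    fix W assume W: "W \<in> vwords A (tail (graph A) e)"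
      and U: "U = [(Edge e, False)] @ W @ [(Edge e, True)]" and t: "eps A W \<in> i_part A e"
    obtain h where h: "h \<in> carrier (egrp A e)" "eps A W = eps A (vword (iword A e h))"
      using t by (auto simp: i_part_def)
    note r = edge_relation(2)[OF A e h(1)]
    then have "vword (iword A e h) \<in> swords (bass_gens A)"
      by (auto simp: conjugates_into_def dest!: pres_eq_swords)
    then have "conjugates_into A (e, False) W (vword (tword A e h))"
      using conjugates_into_cong[OF A _ eq[OF h(2)] r] e by simp
    then show ?thesis using that[of "(e, False)"] W e U by (auto simp: edge_letter_def inv_letter_def)
  qed
qed

section \<open>Stacks of reduced words\<close>

type_synonym ('e, 's) stack_entry = "('e, 's) bass_sym sword \<times> 'e sletter"

text \<open>The head of the list is the top of the stack, that is, the rightmost part of the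
  word.\<close>

fun entries_word :: "('e, 's) stack_entry list \<Rightarrow> ('e, 's) bass_sym sword" where
  "entries_word [] = []"
| "entries_word ((a, d) # T) = entries_word T @ a @ [edge_letter d]"

text \<open>The vertex at which the stored path ends. Only the top entry matters, so the finite
  control can compute it.\<close>

fun current :: "('v, 'e, 'g, 'h, 's) presented_gog \<Rightarrow> 'v \<Rightarrow> ('e, 's) stack_entry option \<Rightarrow> 'v" where
  "current A v None = v"
| "current A v (Some (a, d)) = sterm (graph A) d"

fun top_of :: "'a list \<Rightarrow> 'a option" where
  "top_of [] = None"
| "top_of (x # T) = Some x"

text \<open>The entry \<open>(a, d)\<close> is the one about to be pushed, so \<open>d' a d\<close>
  is the subword at stake.\<close>

fun cancels_top ::
  "('v, 'e, 'g, 'h, 's) presented_gog \<Rightarrow> ('e, 's) stack_entry option \<Rightarrow> ('e, 's) stack_entry \<Rightarrow> bool" where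
  "cancels_top A None x = False"
| "cancels_top A (Some (a', d')) (a, d) \<longleftrightarrow> d = inv_letter d' \<and> (\<exists>V. conjugates_into A d' a V)"

definition reduced_vword ::
  "('v, 'e, 'g, 'h, 's) presented_gog \<Rightarrow> 'v \<Rightarrow> ('e, 's) bass_sym sword \<Rightarrow> bool" where
  "reduced_vword A w a \<longleftrightarrow> a \<in> vwords A w \<and> a \<in> vertex_reps A \<and> freely_reduced a"

fun reduced_entries ::
  "('v, 'e, 'g, 'h, 's) presented_gog \<Rightarrow> 'v \<Rightarrow> ('e, 's) stack_entry list \<Rightarrow> bool" where
  "reduced_entries A v [] = True"
| "reduced_entries A v ((a, d) # T) \<longleftrightarrow>
    reduced_entries A v T \<and> reduced_vword A (current A v (top_of T)) a \<and>
    fst d \<in> arcs (graph A) \<and> sinit (graph A) d = current A v (top_of T) \<and>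
    \<not> cancels_top A (top_of T) (a, d)"

lemma vwords_simps [simp]:
  "[] \<in> vwords A w"
  "l # U \<in> vwords A w \<longleftrightarrow> fst l \<in> Gen ` gens A w \<and> U \<in> vwords A w"
  "U @ V \<in> vwords A w \<longleftrightarrow> U \<in> vwords A w \<and> V \<in> vwords A w"
  by (simp_all add: vwords_def)

lemma edge_letter_notin_vwords: "U \<in> vwords A w \<Longrightarrow> edge_letter d \<notin> set U"
  by (induction U) (auto simp: edge_letter_def)

lemma reduced_vwordD:
  assumes "reduced_vword A w a"
  shows "edge_letter d \<notin> set a" "\<not> sublist [l, inv_letter l] a"
  using assms edge_letter_notin_vwords unfolding reduced_vword_def freely_reduced_def by metis+

section \<open>Locating cancellations in the word of a stack\<close>

lemma edge_letter_inj: "edge_letter d = edge_letter d' \<longleftrightarrow> d = d'"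
  by (cases d; cases d') (auto simp: edge_letter_def)

text \<open>As \<open>p'\<close> does not occur to the right of the marked \<open>p\<close>, the
  marked \<open>p'\<close> is either that very position or lies to its left.\<close>

lemma split_last_marked:
  assumes "xs @ p # ys = xs' @ p' # ys'" "p' \<notin> set ys"
  shows "(xs = xs' \<and> p = p' \<and> ys = ys') \<or> (\<exists>zs. xs = xs' @ p' # zs \<and> ys' = zs @ p # ys)"
  using assms by (auto simp: append_eq_append_conv2 append_eq_Cons_conv Cons_eq_append_conv)

text \<open>Vertex words contain no edge letters, so two edge letters separated by vertex letters
  only must belong to adjacent stack entries, and the word between them is the one stored in the
  upper entry.\<close>

lemma cancellable_position:
  assumes "reduced_entries A v T" "reduced_vword A (current A v (top_of T)) a"
    and "entries_word T @ a = X @ edge_letter d # V @ edge_letter d' # Y" "V \<in> vwords A w"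
  shows "\<exists>x. \<exists>T1 T2. T = T2 @ (V, d') # (x, d) # T1"
  using assms
proof (induction T arbitrary: a Y)
  case Nil
  then have "edge_letter d \<in> set a" by simp
  then show ?case using reduced_vwordD(1)[OF Nil(2)] by blast
next
  case (Cons x T)
  obtain a1 d1 where x: "x = (a1, d1)" by (cases x)
  have a1: "reduced_entries A v T" "reduced_vword A (current A v (top_of T)) a1"
    using Cons.prems(1) x by auto
  have "(entries_word T @ a1) @ edge_letter d1 # a =
      (X @ edge_letter d # V) @ edge_letter d' # Y"
    using Cons.prems(3) x by simp
  moreover have "edge_letter d' \<notin> set a"
    by (rule reduced_vwordD(1)[OF Cons.prems(2)])
  \<comment> \<open>\<open>d1\<close> is the last edge letter of the whole word: it is the right end
    of the pattern, or the pattern lies entirely to its left.\<close>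
  ultimately consider
      "entries_word T @ a1 = X @ edge_letter d # V" "d1 = d'"
    | zs where "entries_word T @ a1 = (X @ edge_letter d # V) @ edge_letter d' # zs"
    using split_last_marked[of "entries_word T @ a1" "edge_letter d1" a] edge_letter_inj by blast
  then show ?case
  proof cases
    case 1
    show ?thesis
    proof (cases T)
      case Nil
      then have "edge_letter d \<in> set a1" using 1 by simp
      then show ?thesis using reduced_vwordD(1)[OF a1(2)] by blast
    next
      case (Cons y T')
      obtain a2 d2 where y: "y = (a2, d2)" by (cases y)
      have "(entries_word T' @ a2) @ edge_letter d2 # a1 = X @ edge_letter d # V"
        using 1(1) Cons y by simp
      \<comment> \<open>\<open>d2\<close> and \<open>d\<close> are both the last edge letter of the
        same word, hence equal.\<close>
      moreover have "edge_letter d \<notin> set a1" "edge_letter d2 \<notin> set V"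
        by (rule reduced_vwordD(1)[OF a1(2)], rule edge_letter_notin_vwords[OF assms(4)])
      ultimately have "d2 = d" "a1 = V"
        using split_last_marked[of "entries_word T' @ a2" "edge_letter d2" a1 X "edge_letter d" V]
          edge_letter_inj[of d2 d] by auto
      then have "x # T = [] @ (V, d') # (a2, d) # T'" using x y Cons 1 by simp
      then show ?thesis by blast
    qed
  next
    case (2 zs)
    from Cons.IH[OF a1, of zs] 2 assms(4) obtain y T1 T2
      where "T = T2 @ (V, d') # (y, d) # T1" by auto
    then have "x # T = (x # T2) @ (V, d') # (y, d) # T1" by simp
    then show ?thesis by blast
  qed
qed

lemma reduced_entries_no_cancellation:
  assumes "reduced_entries A v (T2 @ (V, d') # (x, d) # T1)"
  shows "\<not> (d' = inv_letter d \<and> (\<exists>V'. conjugates_into A d V V'))"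
  using assms by (induction T2) auto

lemma inv_letter_involution [simp]: "inv_letter (inv_letter l) = l"
  by (simp add: inv_letter_def)

text \<open>An inverse pair of vertex letters cannot straddle an edge letter, so it would lie inside
  a single vertex word, and these are freely reduced.\<close>

lemma gen_pair_position:
  assumes "reduced_entries A v T" "reduced_vword A (current A v (top_of T)) a"
    and "entries_word T @ a = X @ [l, inv_letter l] @ Y" "\<And>d. l \<noteq> edge_letter d"
  shows False
  using assms
proof (induction T arbitrary: a Y)
  case Nil
  then have "sublist [l, inv_letter l] a" by (auto simp: sublist_def)
  then show ?case using reduced_vwordD(2)[OF Nil(2)] by blast
next
  case (Cons x T)
  obtain a1 d1 where x: "x = (a1, d1)" by (cases x)
  have a1: "reduced_entries A v T" "reduced_vword A (current A v (top_of T)) a1"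
    using Cons.prems(1) x by auto
  have l: "l \<noteq> edge_letter d1" "inv_letter l \<noteq> edge_letter d1"
    using Cons.prems(4) edge_letter_inv_letter inv_letter_involution by metis+
  have "(entries_word T @ a1) @ edge_letter d1 # a = X @ l # inv_letter l # Y"
    using Cons.prems(3) x by simp
  then consider Z where "entries_word T @ a1 = X @ [l, inv_letter l] @ Z"
    | Z where "a = Z @ [l, inv_letter l] @ Y"
    using l by (auto simp: append_eq_append_conv2 append_eq_Cons_conv Cons_eq_append_conv)
  then show ?case
  proof cases
    case 1
    then show ?thesis using Cons.IH[OF a1 _ Cons.prems(4)] by blast
  next
    case 2
    then have "sublist [l, inv_letter l] a" by (auto simp: sublist_def)
    then show ?thesis using reduced_vwordD(2)[OF Cons.prems(2)] by blast
  qed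
qed

lemma current_verts:
  assumes "is_presented_gog A" "v \<in> verts (graph A)" "reduced_entries A v T"
  shows "current A v (top_of T) \<in> verts (graph A)"
proof (cases T)
  case (Cons x T')
  obtain a d where x: "x = (a, d)" by (cases x)
  then show ?thesis using assms Cons arcs_verts(2)[OF assms(1), of d] by simp
qed (use assms in simp)

lemma edge_letter_bass_gens: "fst d \<in> arcs (graph A) \<Longrightarrow> fst (edge_letter d) \<in> bass_gens A"
  by (simp add: edge_letter_def bass_gens_def)

lemma entries_word_swords:
  assumes A: "is_presented_gog A" and v: "v \<in> verts (graph A)"
  shows "reduced_entries A v T \<Longrightarrow> entries_word T \<in> swords (bass_gens A)"
proof (induction T)
  case (Cons x T)
  obtain a d where x: "x = (a, d)" by (cases x)
  have "current A v (top_of T) \<in> verts (graph A)"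
    using current_verts[OF A v] Cons.prems x by simp
  then have "a \<in> swords (bass_gens A)"
    using Cons.prems x vwords_subset[of "current A v (top_of T)" A] by (auto simp: reduced_vword_def)
  then show ?case using Cons x edge_letter_bass_gens[of d A] by auto
qed simp

text \<open>Cancellable subwords and inverse pairs of edge letters would give two adjacent entries
  that the stack invariant forbids; inverse pairs of vertex letters are excluded by
  \<open>gen_pair_position\<close>.\<close>

lemma reduced_entries_word:
  assumes A: "is_presented_gog A" and v: "v \<in> verts (graph A)"
    and T: "reduced_entries A v T" and a: "reduced_vword A (current A v (top_of T)) a"
  shows "reduced A (entries_word T @ a)"
proof -
  have no: False if eq: "entries_word T @ a = X @ edge_letter d # V @ edge_letter (inv_letter d) # Y"
    and V: "V \<in> vwords A w" and c: "conjugates_into A d V V'" for X d V Y V' w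
  proof -
    obtain x T1 T2 where "T = T2 @ (V, inv_letter d) # (x, d) # T1"
      using cancellable_position[OF T a eq V] by auto
    then show False using reduced_entries_no_cancellation[of A v T2 V "inv_letter d" x d T1] T c
      by auto
  qed
  have sw: "entries_word T @ a \<in> swords (bass_gens A)"
    using entries_word_swords[OF A v T] a vwords_subset[OF current_verts[OF A v T]]
    by (auto simp: reduced_vword_def)
  moreover have "freely_reduced (entries_word T @ a)"
    unfolding freely_reduced_def
  proof
    assume "\<exists>l. sublist [l, inv_letter l] (entries_word T @ a)"
    then obtain l X Y where l: "entries_word T @ a = X @ [l, inv_letter l] @ Y"
      unfolding sublist_def by blast
    show False
    proof (cases "\<exists>d. l = edge_letter d")
      case True
      then obtain d where d: "l = edge_letter d" by blast
      have "fst l \<in> bass_gens A" using sw unfolding l by simp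
      then have "fst d \<in> arcs (graph A)" by (auto simp: d edge_letter_def bass_gens_def)
      from no[of X d "[]" Y v, OF _ _ conjugates_into_Nil[OF this]] l d show False
        by (simp add: edge_letter_inv_letter)
    next
      case False
      then show False using gen_pair_position[OF T a l] by blast
    qed
  qed
  moreover have False if "sublist U (entries_word T @ a)" "cancellable A U" for U
  proof -
    from cancellable_conjugates_into[OF A that(2)] obtain d W V where
      W: "W \<in> vwords A (sterm (graph A) d)"
      "U = [edge_letter d] @ W @ [edge_letter (inv_letter d)]" "conjugates_into A d W V" by metis
    from that(1) obtain X Y where "entries_word T @ a = X @ U @ Y" unfolding sublist_def by blast
    with no[of X d W Y, OF _ W(1,3)] W(2) show False by simp
  qed
  ultimately show ?thesis unfolding reduced_def by blast
qed

section \<open>The reduction algorithm\<close>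

text \<open>\<open>Read t a\<close> scans, with \<open>t\<close> the top of the stack and
  \<open>a\<close> the vertex word after it. \<open>Save\<close> and \<open>Restore\<close> are the
  second halves of a push and of a cancellation; \<open>Emit t w\<close> writes the pending letters
  \<open>w\<close>. With the top entry in the state, a transition can test for a cancellation at
  once.\<close>

datatype ('e, 's) reducer_state =
  Read "('e, 's) stack_entry option" "('e, 's) bass_sym sword"
| Save "('e, 's) stack_entry option" "('e, 's) stack_entry"
| Restore "('e, 's) bass_sym sword"
| Emit "('e, 's) stack_entry option" "('e, 's) bass_sym sword"

text \<open>Output is pushed last letter first, hence \<open>rev a\<close>. In a cancellation,
  \<open>a\<close> conjugated by \<open>d'\<close> becomes a vertex word, which is merged with the
  word \<open>a'\<close> that precedes \<open>d'\<close>.\<close>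

fun read_letter ::
  "('v, 'e, 'g, 'h, 's) presented_gog \<Rightarrow> 'v \<Rightarrow> ('e, 's) stack_entry option \<Rightarrow>
    ('e, 's) bass_sym sword \<Rightarrow> ('e, 's) bass_sym sletter option \<Rightarrow> ('e, 's) reducer_state" where
  "read_letter A v t a None = Emit t (rev a)"
| "read_letter A v t a (Some (Gen s, b)) =
    Read t (rep_word A (current A v t) (a @ [(Gen s, b)]))"
| "read_letter A v t a (Some (Edge e, b)) =
    (if cancels_top A t (a, (e, b)) then
       (case the t of (a', d') \<Rightarrow>
         Restore (rep_word A (sinit (graph A) d') (a' @ (SOME V. conjugates_into A d' a V))))
     else Save t (a, (e, b)))"

text \<open>The stack holds optional entries, with \<open>None\<close> beneath the lowest one;
  \<open>Option.bind y id\<close> treats this marker and an empty stack alike.\<close>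

fun reducer ::
  "('v, 'e, 'g, 'h, 's) presented_gog \<Rightarrow> 'v \<Rightarrow> ('e, 's) reducer_state \<Rightarrow>
    (('e, 's) reducer_state, ('e, 's) stack_entry option, ('e, 's) bass_sym sletter) action" where
  "reducer A v (Read t a) = PopIn (read_letter A v t a)"
| "reducer A v (Save t x) = PushStack t (Read (Some x) [])"
| "reducer A v (Restore a) = PopStack (\<lambda>y. Read (Option.bind y id) a)"
| "reducer A v (Emit t (l # w)) = PushIn l (Emit t w)"
| "reducer A v (Emit (Some (a, d)) []) = PopStack (\<lambda>y. Emit (Option.bind y id) (edge_letter d # rev a))"
| "reducer A v (Emit None []) = Halt"

text \<open>The top entry is kept in the state of the reducer; these are the entries below it.\<close>

fun below :: "'a list \<Rightarrow> 'a option list" where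
  "below [] = []"
| "below (x # T) = top_of T # below T"

text \<open>Letterwise form of the decomposition in \<open>represents\<close>, suited to induction
  along a scan that carries the current vertex.\<close>

fun path_word ::
  "('v, 'e, 'g, 'h, 's) presented_gog \<Rightarrow> 'v \<Rightarrow> ('e, 's) bass_sym sword \<Rightarrow> bool" where
  "path_word A u [] = True"
| "path_word A u ((Gen s, b) # W) \<longleftrightarrow> s \<in> gens A u \<and> path_word A u W"
| "path_word A u ((Edge e, b) # W) \<longleftrightarrow>
    e \<in> arcs (graph A) \<and> sinit (graph A) (e, b) = u \<and> path_word A (sterm (graph A) (e, b)) W"

lemma path_word_append:
  assumes "U \<in> vwords A u" "path_word A u W"
  shows "path_word A u (U @ W)"
  using assms(1)
proof (induction U)
  case (Cons l U)
  then show ?case by (cases l) auto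
qed (use assms(2) in simp)

lemma represents_path_word:
  assumes "represents A v W g"
  shows "path_word A v W"
proof -
  obtain W0 p where W: "W = W0 @ concat (map (\<lambda>(d, U). edge_letter d # U) p)"
    and p: "is_path (graph A) v (map fst p) v" "W0 \<in> vwords A v"
      "\<forall>(d, U) \<in> set p. U \<in> vwords A (sterm (graph A) d)"
    using assms by (auto simp: represents_def)
  have "path_word A u (concat (map (\<lambda>(d, U). edge_letter d # U) p))"
    if "is_path (graph A) u (map fst p) v" for u
    using that p(3)
  proof (induction p arbitrary: u)
    case (Cons x p)
    obtain e b U where x: "x = ((e, b), U)" by (metis surj_pair)
    then show ?case
      using Cons by (auto simp: edge_letter_def intro!: path_word_append)
  qed simp
  from path_word_append[OF p(2) this[OF p(1)]] show ?thesis by (simp only: W)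
qed

lemma path_word_swords:
  assumes A: "is_presented_gog A"
  shows "u \<in> verts (graph A) \<Longrightarrow> path_word A u W \<Longrightarrow> W \<in> swords (bass_gens A)"
proof (induction W arbitrary: u)
  case (Cons l W)
  obtain x b where l: "l = (x, b)" by (cases l)
  show ?case
  proof (cases x)
    case (Gen s)
    then show ?thesis using Cons l by (auto simp: bass_gens_def)
  next
    case (Edge e)
    then have "e \<in> arcs (graph A)" "path_word A (sterm (graph A) (e, b)) W"
      using Cons.prems l by auto
    moreover from this have "sterm (graph A) (e, b) \<in> verts (graph A)"
      using arcs_verts(2)[OF A, of "(e, b)"] by simp
    ultimately show ?thesis using Cons.IH l Edge by (auto simp: bass_gens_def)
  qed
qed simp

section \<open>Reading the input\<close>

lemma reduced_vword_rep_word: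
  assumes "w \<in> verts (graph A)" "U \<in> vwords A w"
  shows "reduced_vword A w (rep_word A w U)"
  using rep_word(1)[OF assms]
  by (simp add: reduced_vword_def rep_word_in_vertex_reps freely_reduced_rep_word)

lemma reduced_vword_Nil: "reduced_vword A w []"
  by (simp add: reduced_vword_def vertex_reps_def freely_reduced_def)

lemma cancel_on_top:
  assumes A: "is_presented_gog A" and sw: "X \<in> swords (bass_gens A)" "Y \<in> swords (bass_gens A)"
    "a' \<in> swords (bass_gens A)" and c: "conjugates_into A d a V"
  shows "bass_eq A (X @ a' @ edge_letter d # a @ edge_letter (inv_letter d) # Y) (X @ (a' @ V) @ Y)"
proof -
  have "bass_eq A (edge_letter d # a @ [edge_letter (inv_letter d)]) V"
    using c by (simp add: conjugates_into_def edge_letter_inv_letter)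
  then have "bass_eq A ((X @ a') @ (edge_letter d # a @ [edge_letter (inv_letter d)]) @ Y) ((X @ a') @ V @ Y)"
    using sw by (intro pres_eq_context) auto
  then show ?thesis by simp
qed

text \<open>Induction on the unread input. The stack followed by \<open>a\<close> stays reduced, and
  together with the unread letters it keeps its value in the Bass group. A letter costs one pop of
  the input and at most one stack action, and adds at most one entry.\<close>

lemma read_phase:
  assumes A: "is_presented_gog A" and v: "v \<in> verts (graph A)"
  shows "reduced_entries A v T \<Longrightarrow> reduced_vword A (current A v (top_of T)) a \<Longrightarrow>
    path_word A (current A v (top_of T)) W \<Longrightarrow>
    \<exists>n\<le>2 * length W. \<exists>T' a'.
      (stack_step (reducer A v) ^^ n) (Read (top_of T) a, W, below T) = (Read (top_of T') a', [], below T') \<and>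
      reduced_entries A v T' \<and> reduced_vword A (current A v (top_of T')) a' \<and>
      length T' \<le> length T + length W \<and>
      bass_eq A (entries_word T @ a @ W) (entries_word T' @ a')"
proof (induction W arbitrary: T a)
  case Nil
  have "entries_word T @ a \<in> swords (bass_gens A)"
    using reduced_entries_word[OF A v Nil(1,2)] by (simp add: reduced_def)
  then have "bass_eq A (entries_word T @ a @ []) (entries_word T @ a)"
    by (simp add: pres_eq.refl)
  then show ?case using Nil by (auto intro!: exI[of _ T] exI[of _ a])
next
  case (Cons l W)
  let ?w = "current A v (top_of T)"
  let ?M = "stack_step (reducer A v)"
  have w: "?w \<in> verts (graph A)" by (rule current_verts[OF A v Cons.prems(1)])
  have ET: "entries_word T \<in> swords (bass_gens A)" by (rule entries_word_swords[OF A v Cons.prems(1)])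
  have aw: "a \<in> vwords A ?w" using Cons.prems(2) by (simp add: reduced_vword_def)
  then have asw: "a \<in> swords (bass_gens A)" using vwords_subset[OF w] by auto
  have lW: "l # W \<in> swords (bass_gens A)" by (rule path_word_swords[OF A w Cons.prems(3)])
  \<comment> \<open>Composes the treatment of one letter with the induction hypothesis; each case
    below only has to name the stack \<open>T1\<close> and the word \<open>a1\<close>
    reached.\<close>
  have finish: ?case
    if T1: "reduced_entries A v T1" "reduced_vword A (current A v (top_of T1)) a1"
        "path_word A (current A v (top_of T1)) W" "length T1 \<le> Suc (length T)"
      and k: "k \<le> 2" "(?M ^^ k) (Read (top_of T) a, l # W, below T) = (Read (top_of T1) a1, W, below T1)"
      and eq: "bass_eq A (entries_word T @ a @ l # W) (entries_word T1 @ a1 @ W)" for T1 a1 k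
  proof -
    obtain n T' a' where n: "n \<le> 2 * length W"
      "(?M ^^ n) (Read (top_of T1) a1, W, below T1) = (Read (top_of T') a', [], below T')"
      "reduced_entries A v T'" "reduced_vword A (current A v (top_of T')) a'"
      "length T' \<le> length T1 + length W" "bass_eq A (entries_word T1 @ a1 @ W) (entries_word T' @ a')"
      using Cons.IH[OF T1(1-3)] by blast
    have "(?M ^^ (n + k)) (Read (top_of T) a, l # W, below T) = (Read (top_of T') a', [], below T')"
      unfolding funpow_add comp_def k(2) by (rule n(2))
    moreover have "n + k \<le> 2 * length (l # W)" "length T' \<le> length T + length (l # W)"
      using n k T1 by auto
    moreover have "bass_eq A (entries_word T @ a @ l # W) (entries_word T' @ a')"
      using eq n(6) by (rule pres_eq.trans)
    ultimately show ?thesis using n(3,4) by blast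
  qed
  obtain x b where l: "l = (x, b)" by (cases l)
  show ?case
  proof (cases x)
    case (Gen s)
    let ?a = "rep_word A ?w (a @ [l])"
    have s: "s \<in> gens A ?w" "path_word A ?w W" using Cons.prems(3) l Gen by auto
    have al: "a @ [l] \<in> vwords A ?w" using aw s l Gen by auto
    have "bass_eq A (entries_word T @ (a @ [l]) @ W) (entries_word T @ ?a @ W)"
      using ET lW rep_word(2)[OF w al] by (intro pres_eq_context) auto
    then show ?thesis
      using finish[OF Cons.prems(1) reduced_vword_rep_word[OF w al] s(2), of 1] l Gen by simp
  next
    case (Edge e)
    let ?d = "(e, b)"
    have le: "l = edge_letter ?d" using l Edge by (simp add: edge_letter_def)
    have e: "e \<in> arcs (graph A)" "sinit (graph A) ?d = ?w" "path_word A (sterm (graph A) ?d) W"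
      using Cons.prems(3) l Edge by auto
    show ?thesis
    proof (cases "cancels_top A (top_of T) (a, ?d)")
      case False
      \<comment> \<open>The failed test is exactly the condition that the invariant imposes on the
        new entry.\<close>
      have T1: "reduced_entries A v ((a, ?d) # T)" using Cons.prems e False by simp
      have "(?M ^^ 2) (Read (top_of T) a, l # W, below T) =
          (Read (top_of ((a, ?d) # T)) [], W, below ((a, ?d) # T))"
        using False l Edge by (simp add: numeral_2_eq_2)
      moreover have "bass_eq A (entries_word T @ a @ l # W) (entries_word ((a, ?d) # T) @ [] @ W)"
        using ET asw lW by (auto simp: le intro!: pres_eq.refl)
      ultimately show ?thesis
        using finish[OF T1 reduced_vword_Nil, of 2] e(3) by simp
    next
      case True
      then obtain a' d' T' where T: "T = (a', d') # T'"
        by (cases T) auto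
      have d: "?d = inv_letter d'" and ex: "\<exists>V. conjugates_into A d' a V"
        using True T by auto
      define V where "V = (SOME V. conjugates_into A d' a V)"
      have V: "conjugates_into A d' a V" unfolding V_def using someI_ex[OF ex] .
      let ?u = "sinit (graph A) d'"
      have T': "reduced_entries A v T'" "reduced_vword A ?u a'" "?u = current A v (top_of T')"
        using Cons.prems(1) T by auto
      have u: "?u \<in> verts (graph A)" using current_verts[OF A v T'(1)] T'(3) by simp
      have aV: "a' @ V \<in> vwords A ?u" using T'(2) V by (simp add: reduced_vword_def conjugates_into_def)
      then have aVs: "a' @ V \<in> swords (bass_gens A)" using vwords_subset[OF u] by auto
      let ?a = "rep_word A ?u (a' @ V)"
      have ET': "entries_word T' \<in> swords (bass_gens A)" by (rule entries_word_swords[OF A v T'(1)])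
      \<comment> \<open>The letter read is inverse to \<open>d'\<close>, so the path is back at the
        vertex where the rest of the stack ends.\<close>
      have "sterm (graph A) ?d = current A v (top_of T')"
        unfolding d T'(3)[symmetric] by (rule sterm_inv_letter)
      then have path: "path_word A (current A v (top_of T')) W" using e(3) by simp
      \<comment> \<open>The symbol popped in \<open>Restore\<close> is \<open>top_of T'\<close>,
        which becomes the top entry in the state.\<close>
      have step: "(?M ^^ 2) (Read (top_of T) a, l # W, below T) = (Read (top_of T') ?a, W, below T')"
        using True l Edge by (simp add: numeral_2_eq_2 T V_def)
      have "bass_eq A (entries_word T' @ a' @ edge_letter d' # a @ edge_letter (inv_letter d') # W)
          (entries_word T' @ (a' @ V) @ W)"
        using ET' lW aVs V by (intro cancel_on_top[OF A]) auto
      moreover have "bass_eq A (entries_word T' @ (a' @ V) @ W) (entries_word T' @ ?a @ W)"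
        using ET' lW rep_word(2)[OF u aV] by (intro pres_eq_context) auto
      ultimately have "bass_eq A (entries_word T @ a @ l # W) (entries_word T' @ ?a @ W)"
        unfolding le d T by (auto intro: pres_eq.trans)
      moreover have "reduced_vword A (current A v (top_of T')) ?a"
        using reduced_vword_rep_word[OF u aV] T'(3) by simp
      ultimately show ?thesis
        using finish[OF T'(1) _ path _ _ step] T by simp
    qed
  qed
qed

section \<open>Writing out the stack\<close>

lemma emit_word:
  "(stack_step (reducer A v) ^^ length w) (Emit t w, u, s) = (Emit t [], rev w @ u, s)"
  by (induction w arbitrary: u) (simp_all add: funpow_step_Suc del: funpow.simps(2))

text \<open>One step per letter and one pop per entry. Entries leave the stack from right to left,
  which is the order in which pushing builds a word.\<close>

lemma emit_entries:
  "(stack_step (reducer A v) ^^ (length (entries_word T) + length T)) (Emit (top_of T) [], u, below T) =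
     (Emit None [], entries_word T @ u, [])"
proof (induction T arbitrary: u)
  case (Cons x T)
  let ?M = "stack_step (reducer A v)"
  obtain a d where x: "x = (a, d)" by (cases x)
  let ?w = "edge_letter d # rev a"
  have n: "length (entries_word (x # T)) + length (x # T) =
      (length (entries_word T) + length T) + (length ?w + 1)"
    by (simp add: x)
  have "(?M ^^ (length ?w + 1)) (Emit (top_of (x # T)) [], u, below (x # T)) =
      (?M ^^ length ?w) (Emit (top_of T) ?w, u, below T)"
    by (simp add: x funpow_step_Suc del: funpow.simps)
  also have "\<dots> = (Emit (top_of T) [], rev ?w @ u, below T)" by (rule emit_word)
  finally have "(?M ^^ (length ?w + 1)) (Emit (top_of (x # T)) [], u, below (x # T)) =
      (Emit (top_of T) [], rev ?w @ u, below T)" .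
  then have "(?M ^^ (length (entries_word (x # T)) + length (x # T))) (Emit (top_of (x # T)) [], u, below (x # T)) =
      (Emit None [], entries_word T @ rev ?w @ u, [])"
    unfolding n funpow_add[of "length (entries_word T) + length T"] comp_def by (simp only: Cons.IH)
  then show ?case by (simp add: x)
qed simp

lemma vertex_reps_swords: "a \<in> vertex_reps A \<Longrightarrow> a \<in> swords (bass_gens A)"
proof -
  assume "a \<in> vertex_reps A"
  then consider "a = []" | w U where "w \<in> verts (graph A)" "U \<in> vwords A w" "a = rep_word A w U"
    by (auto simp: vertex_reps_def)
  then show ?thesis
  proof cases
    case (2 w U)
    then show ?thesis using rep_word(1)[OF 2(1,2)] vwords_subset[OF 2(1)] by auto
  qed simp
qed

text \<open>Entries and vertex words in a state range over finite sets, because there are finitely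
  many representatives, and pending output has bounded length.\<close>

lemma reducer_within:
  assumes A: "is_presented_gog A" and G: "fin_digraph (graph A)"
    and fing: "\<And>w. w \<in> verts (graph A) \<Longrightarrow> finite (carrier (vgrp A w))"
  obtains Q C where "finite Q" "finite C" "Read None [] \<in> Q"
    "\<And>q. q \<in> Q \<Longrightarrow> actions_within Q C (bass_gens A \<times> UNIV) (reducer A v q)"
proof -
  let ?X = "bass_gens A \<times> (UNIV :: bool set)"
  have V: "finite (verts (graph A))" "finite (arcs (graph A))"
    using G by (simp_all add: fin_digraph.finite_verts fin_digraph.finite_arcs)
  have R: "finite (vertex_reps A)" by (rule finite_vertex_reps[OF A V(1) fing])
  have X: "finite ?X"
    using V A by (auto simp: bass_gens_def is_presented_gog_def)
  define E where "E = vertex_reps A \<times> (arcs (graph A) \<times> (UNIV :: bool set))"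
  \<comment> \<open>\<open>C\<close> serves twice: as the range of the top entry in a state and as
    the stack alphabet.\<close>
  define C where "C = insert None (Some ` E)"
  \<comment> \<open>The longest pending output is an edge letter followed by a reversed
    representative, hence the \<open>Suc\<close>.\<close>
  define K where "K = Suc (Max (length ` vertex_reps A))"
  define L where "L = {w. set w \<subseteq> ?X \<and> length w \<le> K}"
  define Q where "Q = case_prod Read ` (C \<times> vertex_reps A) \<union> case_prod Save ` (C \<times> E) \<union>
    Restore ` vertex_reps A \<union> case_prod Emit ` (C \<times> L)"
  have C: "finite C" and E: "finite E" using R V by (simp_all add: C_def E_def)
  have Nil: "[] \<in> vertex_reps A" by (simp add: vertex_reps_def)
  have Q: "finite Q"
    unfolding Q_def L_def using C E R
    by (intro finite_UnI finite_imageI finite_cartesian_product finite_lists_length_le[OF X])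
  have mem: "Read t a \<in> Q \<longleftrightarrow> t \<in> C \<and> a \<in> vertex_reps A" "Save t x \<in> Q \<longleftrightarrow> t \<in> C \<and> x \<in> E"
    "Restore a \<in> Q \<longleftrightarrow> a \<in> vertex_reps A" "Emit t w \<in> Q \<longleftrightarrow> t \<in> C \<and> w \<in> L" for t a x w
    by (auto simp: Q_def image_iff)
  have La: "rev a \<in> L" "fst d \<in> arcs (graph A) \<Longrightarrow> edge_letter d # rev a \<in> L" if "a \<in> vertex_reps A" for a d
  proof -
    have "length a \<le> Max (length ` vertex_reps A)" using R that by (intro Max_ge) auto
    moreover have "set a \<subseteq> ?X" using vertex_reps_swords[OF that] by (auto simp: swords_def)
    ultimately show "rev a \<in> L" "fst d \<in> arcs (graph A) \<Longrightarrow> edge_letter d # rev a \<in> L"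
      using edge_letter_bass_gens[of d A] by (auto simp: L_def K_def mem_Times_iff)
  qed
  have tl: "w \<in> L" "l \<in> ?X" if "l # w \<in> L" for l w using that by (auto simp: L_def)
  have None: "None \<in> C" by (simp add: C_def)
  have "actions_within Q C ?X (reducer A v q)" if q: "q \<in> Q" for q
  proof (cases q)
    case (Read t a)
    then have ta: "t \<in> C" "a \<in> vertex_reps A" using q mem by auto
    have "read_letter A v t a (Some x) \<in> Q" if x: "x \<in> ?X" for x
    proof -
      obtain y b where xy: "x = (y, b)" by (cases x)
      show ?thesis
      proof (cases y)
        case (Gen s)
        then show ?thesis using xy ta by (simp add: mem rep_word_in_vertex_reps)
      next
        case (Edge e)
        then have "e \<in> arcs (graph A)" using x xy by (auto simp: bass_gens_def)
        then have "(a, (e, b)) \<in> E" using ta by (simp add: E_def)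
        then show ?thesis
          using Edge xy ta by (auto simp: mem rep_word_in_vertex_reps split: prod.splits)
      qed
    qed
    then show ?thesis using Read ta La(1)[OF ta(2)] by (simp add: actions_within_def mem)
  next
    case (Save t x)
    then have "t \<in> C" "x \<in> E" using q mem by auto
    then show ?thesis using Save Nil by (simp add: actions_within_def mem C_def)
  next
    case (Restore a)
    then have "a \<in> vertex_reps A" using q mem by auto
    then show ?thesis using Restore None by (auto simp: actions_within_def mem)
  next
    case (Emit t w)
    then have tw: "t \<in> C" "w \<in> L" using q mem by auto
    show ?thesis
    proof (cases w)
      case (Cons l w')
      then show ?thesis using Emit tw tl[of l w'] by (simp add: actions_within_def mem)
    next
      case Nil
      show ?thesis
      proof (cases t)
        case None
        then show ?thesis using Emit \<open>w = []\<close> by (simp add: actions_within_def)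
      next
        case (Some x)
        obtain a d where x: "x = (a, d)" by (cases x)
        then have "a \<in> vertex_reps A" "fst d \<in> arcs (graph A)"
          using tw(1) Some by (auto simp: C_def E_def)
        from La(2)[OF this] show ?thesis
          using Emit \<open>w = []\<close> Some x None by (auto simp: actions_within_def mem)
      qed
    qed
  qed
  moreover have "Read None [] \<in> Q" using Nil by (simp add: mem C_def)
  ultimately show ?thesis using that Q C by blast
qed

lemma length_entries_word:
  assumes "reduced_entries A v T" "\<And>a. a \<in> vertex_reps A \<Longrightarrow> length a \<le> K"
  shows "length (entries_word T) \<le> (K + 1) * length T"
  using assms(1)
proof (induction T)
  case (Cons x T)
  obtain a d where x: "x = (a, d)" by (cases x)
  then have "length a \<le> K" using Cons.prems assms(2) by (auto simp: reduced_vword_def)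
  then show ?case using Cons x by auto
qed simp

text \<open>Reading takes at most \<open>2 * length W\<close> steps, noticing the end of the input
  1, writing \<open>a\<close> at most \<open>K\<close>, and writing at most \<open>length W\<close>
  entries at most \<open>(K + 2) * length W\<close>.\<close>

lemma reducer_correct:
  assumes A: "is_presented_gog A" and v: "v \<in> verts (graph A)"
    and K: "\<And>a. a \<in> vertex_reps A \<Longrightarrow> length a \<le> K" and W: "path_word A v W"
  obtains n W' where "n \<le> (K + 4) * length W + K + 1"
    "(stack_step (reducer A v) ^^ n) (Read None [], W, []) = (Emit None [], W', [])"
    "reduced A W'" "bass_eq A W W'"
proof -
  let ?M = "stack_step (reducer A v)"
  obtain n T a where n: "n \<le> 2 * length W" and
    run: "(?M ^^ n) (Read None [], W, []) = (Read (top_of T) a, [], below T)" and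
    T: "reduced_entries A v T" "reduced_vword A (current A v (top_of T)) a" "length T \<le> length W"
    and eq: "bass_eq A W (entries_word T @ a)"
    using read_phase[OF A v, of "[]" "[]" W] W reduced_vword_Nil[of A v] by auto
  let ?m = "length (entries_word T) + length T"
  have "(?M ^^ (?m + (length a + (1 + n)))) (Read None [], W, []) =
      (?M ^^ ?m) ((?M ^^ length a) ((?M ^^ 1) ((?M ^^ n) (Read None [], W, []))))"
    by (simp only: funpow_add comp_def)
  also have "(?M ^^ 1) ((?M ^^ n) (Read None [], W, [])) = (Emit (top_of T) (rev a), [], below T)"
    by (simp add: run)
  also have "(?M ^^ length a) (Emit (top_of T) (rev a), [], below T) = (Emit (top_of T) [], a, below T)"
    using emit_word[where A = A and v = v and w = "rev a" and u = "[]" and t = "top_of T"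
        and s = "below T"] by simp
  also have "(?M ^^ ?m) (Emit (top_of T) [], a, below T) = (Emit None [], entries_word T @ a, [])"
    by (rule emit_entries)
  finally have "(?M ^^ (?m + (length a + (1 + n)))) (Read None [], W, []) =
      (Emit None [], entries_word T @ a, [])" .
  moreover have "?m + (length a + (1 + n)) \<le> (K + 4) * length W + K + 1"
  proof -
    have "(K + 1) * length T \<le> (K + 1) * length W" using T(3) by (rule mult_le_mono2)
    then have "length (entries_word T) \<le> (K + 1) * length W"
      using length_entries_word[OF T(1) K] by linarith
    moreover have "length a \<le> K" using T(2) K by (simp add: reduced_vword_def)
    moreover have "(K + 4) * length W = (K + 1) * length W + 3 * length W"
      by (simp add: add_mult_distrib)
    ultimately show ?thesis using n T(3) by linarith
  qed
  ultimately show ?thesis using that reduced_entries_word[OF A v T(1,2)] eq by blast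
qed

section \<open>Comparing a linear bound with \<open>M * log_star M\<close>\<close>

lemma log_star_ge_1: "2 \<le> n \<Longrightarrow> 1 \<le> log_star n"
proof -
  assume n: "2 \<le> n"
  \<comment> \<open>Ensures that some \<open>m\<close> satisfies \<open>n \<le> two_star m\<close>,
    so that the least one does.\<close>
  have le: "k < two_star k" for k
  proof (induction k)
    case (Suc k)
    then have "Suc k \<le> two_star k" by simp
    also have "\<dots> < 2 ^ two_star k" by (rule less_exp)
    finally show ?case by simp
  qed simp
  have "n \<le> two_star (log_star n)"
    unfolding log_star_def by (rule LeastI[of _ n]) (use le[of n] in simp)
  then show ?thesis using n by (cases "log_star n") auto
qed

text \<open>From 2 on, \<open>log_star\<close> is at least 1, so a linear bound suffices.\<close>

lemma affine_in_bigo_log_star: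
  "(\<lambda>M. real (c * M + d)) \<in> O(\<lambda>M. real M * real (log_star M))"
proof (rule landau_o.bigI[where c = "real (c + d) + 1"])
  show "\<forall>\<^sub>F M in sequentially. norm (real (c * M + d)) \<le> (real (c + d) + 1) * norm (real M * real (log_star M))"
    using eventually_ge_at_top[of 2]
  proof eventually_elim
    case (elim M)
    have "c * M + d \<le> (c + d) * M" using elim by (simp add: add_mult_distrib)
    also have "\<dots> \<le> (c + d + 1) * (M * log_star M)"
      using log_star_ge_1[OF elim] by (intro mult_le_mono) auto
    finally have "norm (real (c * M + d)) \<le> real ((c + d + 1) * (M * log_star M))"
      by (simp only: norm_of_nat of_nat_le_iff)
    also have "\<dots> = (real (c + d) + 1) * norm (real M * real (log_star M))"
      by (simp add: algebra_simps)
    finally show ?case by simp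
  qed
qed simp

theorem proposition6p1:
  fixes A :: "('v, 'e, 'g, 'h, 's) presented_gog"
    and v :: 'v
    and \<sigma> :: "'v \<Rightarrow> 'g \<Rightarrow> 's"
    and code :: "('e, 's) bass_sym sletter \<Rightarrow> nat"
  assumes "is_presented_gog A"
    and "fin_digraph (graph A)"
    and "\<And>w. w \<in> verts (graph A) \<Longrightarrow> finite (carrier (vgrp A w))"
    and "v \<in> verts (graph A)"
    and "symbol_assignment A \<sigma>"
    and "inj_on code (bass_gens A \<times> UNIV)"
  shows "\<exists>B P (T :: nat \<Rightarrow> nat).
    0 < B \<and> (\<forall>l \<in> bass_gens A \<times> UNIV. code l < B) \<and>
    (\<lambda>M. real (T M)) \<in> O(\<lambda>M. real M * real (log_star M)) \<and>
    (\<forall>W g. g \<in> pi1 A v \<and> represents A v W g \<longrightarrow>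
      (\<exists>W' n. n \<le> T (length W) \<and>
              computes_in B P (map code W) n (map code W') \<and>
              reduced A W' \<and> eps A W = eps A W'))"
proof -
  note A = assms(1) and v = assms(4)
  have V: "finite (verts (graph A))" "finite (arcs (graph A))"
    using assms(2) by (simp_all add: fin_digraph.finite_verts fin_digraph.finite_arcs)
  have X: "finite (bass_gens A \<times> (UNIV :: bool set))"
    using V A by (auto simp: bass_gens_def is_presented_gog_def)
  define K where "K = Max (length ` vertex_reps A)"
  have K: "length a \<le> K" if "a \<in> vertex_reps A" for a
    using finite_vertex_reps[OF A V(1) assms(3)] that by (auto simp: K_def)
  obtain Q C where Q: "finite Q" "finite C" "Read None [] \<in> Q"
    "\<And>q. q \<in> Q \<Longrightarrow> actions_within Q C (bass_gens A \<times> UNIV) (reducer A v q)"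
    using reducer_within[OF A assms(2,3), of v] by blast
  obtain B P where
    B: "0 < B" "\<And>l. l \<in> bass_gens A \<times> UNIV \<Longrightarrow> code l < B" and
    sim: "\<And>u n q u' s'. set u \<subseteq> bass_gens A \<times> UNIV \<Longrightarrow>
      (stack_step (reducer A v) ^^ n) (Read None [], u, []) = (q, u', s') \<Longrightarrow> reducer A v q = Halt \<Longrightarrow>
      \<exists>m \<le> 15 * n + 20. computes_in B P (map code u) m (map code u')"
    by (rule stack_machine_simulation[where M = "reducer A v", OF Q(1,2) X assms(6) Q(3,4)]) (assumption, rule that)
  \<comment> \<open>The bound of \<open>reducer_correct\<close> times 15 instructions per action,
    plus 20 for start and halt.\<close>
  define T where "T M = 15 * (K + 4) * M + (15 * (K + 1) + 20)" for M
  have res: "\<exists>W' n. n \<le> T (length W) \<and> computes_in B P (map code W) n (map code W') \<and>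
      reduced A W' \<and> eps A W = eps A W'" if "represents A v W g" for W g
  proof -
    have W: "path_word A v W" by (rule represents_path_word[OF that])
    have sw: "W \<in> swords (bass_gens A)" by (rule path_word_swords[OF A v W])
    obtain n W' where n: "n \<le> (K + 4) * length W + K + 1" and
      run: "(stack_step (reducer A v) ^^ n) (Read None [], W, []) = (Emit None [], W', [])" and
      W': "reduced A W'" "bass_eq A W W'"
      by (rule reducer_correct[OF A v K W])
    have "set W \<subseteq> bass_gens A \<times> UNIV" using sw by (auto simp: swords_def)
    from sim[OF this run] obtain m where
      m: "m \<le> 15 * n + 20" "computes_in B P (map code W) m (map code W')" by auto
    have "15 * n + 20 \<le> T (length W)" using n by (simp add: T_def algebra_simps)
    moreover have "eps A W = eps A W'"
      using W'(2) pres_class_eq_iff[OF sw] by (simp add: eps_def)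
    ultimately have "m \<le> T (length W) \<and> computes_in B P (map code W) m (map code W') \<and>
        reduced A W' \<and> eps A W = eps A W'"
      using m W'(1) by simp
    then show ?thesis by blast
  qed
  have "(\<lambda>M. real (T M)) \<in> O(\<lambda>M. real M * real (log_star M))"
    unfolding T_def by (rule affine_in_bigo_log_star)
  with B res have "0 < B \<and> (\<forall>l \<in> bass_gens A \<times> UNIV. code l < B) \<and>
    (\<lambda>M. real (T M)) \<in> O(\<lambda>M. real M * real (log_star M)) \<and>
    (\<forall>W g. g \<in> pi1 A v \<and> represents A v W g \<longrightarrow>
      (\<exists>W' n. n \<le> T (length W) \<and>
              computes_in B P (map code W) n (map code W') \<and>
              reduced A W' \<and> eps A W = eps A W'))"
    by (intro conjI ballI allI impI) blast+
  then show ?thesis by (intro exI)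
qed

end
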